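(* Let $\mathcal B$ be a euclidean building with chamber set $C$ and let $G$ be a topological group that acts on $\mathcal B$ as a group of automorphisms. Assume that the action of $G$ on the discrete space $C$ of chambers is (continuous and) proper. Then the following are equivalent. (i) The $G$-action is Weyl-transitive. (ii) The $G$-action is strongly transitive on the maximal atlas of $\mathcal B$.
   Context: All topological spaces and groups are Hausdorff. A continuous map is proper if it is closed and preimages of points are compact. A continuous action $G\times X\to X$ of a topological group on a space is proper if the map $G\times X\to X\times X$, $(g,x)\mapsto(gx,x)$ is proper. Coxeter systems. Let $I$ be a finite set and $(m_{i,j})_{i,j\in I}$ a symmetric matrix with entries in $\{1,2,3,\ldots,\infty\}$, $m_{i,i}=1$ and $m_{i,j}\ge 2$ for $i\ne j$. The associated Coxeter system $(W,I)$ consists of the group $W=\langle I\mid (ij)^{m_{i,j}}=1 \text{ if } m_{i,j}\neq\infty\rangle$ and its generating set $I$; $\ell$ is the word length with respect to $I$, and $w=i_1\cdots i_m$ (with $i_s\in I$) is reduced if $\ell(w)=m$. Buildings. A building $\mathcal B=(C,EC,t,\delta)$ of type $(W,I)$ consists of a simplicial graph $(C,EC)$ with vertex set $C$ (the chambers) and edge set $EC$, an edge coloring $t:EC\to I$, and a map $\delta:C\times C\to W$. Chambers joined by an edge of color $i$ are called $i$-adjacent. A gallery of type $(i_1,\ldots,i_m)$ is a sequence $(c_0,\ldots,c_m)$ of chambers with $c_{s-1}$ $i_s$-adjacent to $c_s$. Axioms: (B1) for every chamber $a$ and $i\in I$ there is at least one chamber $b$ which is $i$-adjacent to $a$, and if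 another chamber $c$ is $i$-adjacent to $a$, then $b$ and $c$ are $i$-adjacent; (B2) if $w=i_1\cdots i_m$ is reduced, then $\delta(a,b)=w$ if and only if there is a gallery of type $(i_1,\ldots,i_m)$ from $a$ to $b$. An automorphism of $\mathcal B$ is a graph automorphism preserving the edge coloring. Apartments. A subbuilding is a full subgraph which is itself a building of the same type $(W,I)$. A building is thin if for every chamber $a$ and $i\in I$ there is precisely one other chamber $i$-adjacent to $a$. An apartment of $\mathcal B$ is a thin subbuilding. An atlas is a set of apartments such that every pair of chambers is contained in at least one of them; the maximal atlas is the set of all apartments of $\mathcal B$. Transitivity. An action of $G$ on $\mathcal B$ by automorphisms is Weyl-transitive if for all chambers $a,b,a',b'$ with $\delta(a,b)=\delta(a',b')$ there is $g\in G$ with $ga=a'$ and $gb=b'$. It is strongly transitive on an atlas $\mathbf A$ if it preserves $\mathbf A$ and if for all $a\in A\in\mathbf A$ and $a'\in A'\in\mathbf A$ there is $g\in G$ with $ga=a'$ and $gA=A'$. Euclidean buildings. Let $\mathcal H$ be a locally finite collection of affine hyperplanes in a euclidean space $\mathbb R^m$ which is invariant under the group $W$ generated by the reflections along the hyperplanes in $\mathcal H$, and suppose that $W$ acts cocompactly on $\mathbb R^m$. Then there is a compact convex polytope, bounded by finitely many hyperplanes in $\mathcal H$, which is a fundamental domain for $W$; if $I$ is the set of reflections along its codimension $1$ faces, then $(W,I)$ is a Coxeter system, said to be of euclidean type. A building is called euclidean if its type $(W,I)$ is a Coxeter system of euclidean type (not necessarily irreducible). *)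

theory Defs
  imports
    "HOL-Analysis.Analysis"
    "HOL-Algebra.Group_Action"
    "HOL-Algebra.Elementary_Groups"
    "HOL-Library.Extended_Nat"
begin

section \<open>Coxeter systems\<close>

definition coxeter_matrix :: "'i set \<Rightarrow> ('i \<Rightarrow> 'i \<Rightarrow> enat) \<Rightarrow> bool" where
  "coxeter_matrix I M \<longleftrightarrow> finite I \<and>
     (\<forall>i\<in>I. M i i = 1) \<and>
     (\<forall>i\<in>I. \<forall>j\<in>I. M i j = M j i) \<and>
     (\<forall>i\<in>I. \<forall>j\<in>I. i \<noteq> j \<longrightarrow> M i j \<ge> 2)"

text \<open>
  Equality of words in \<open>\<langle>I | (ij)^(M i j) = 1 if M i j \<noteq> \<infinity>\<rangle>\<close>. Since \<open>M i i = 1\<close>, the relators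
  include \<open>ii\<close>; every generator is its own inverse, so no formal inverses of letters are
  needed and the quotient of the word monoid is the group with this presentation.
\<close>

inductive word_eq :: "'i set \<Rightarrow> ('i \<Rightarrow> 'i \<Rightarrow> enat) \<Rightarrow> 'i list \<Rightarrow> 'i list \<Rightarrow> bool"
  for I M where
  refl: "u \<in> lists I \<Longrightarrow> word_eq I M u u"
| sym: "word_eq I M u v \<Longrightarrow> word_eq I M v u"
| trans: "word_eq I M u v \<Longrightarrow> word_eq I M v w \<Longrightarrow> word_eq I M u w"
| relator: "\<lbrakk>u \<in> lists I; v \<in> lists I; i \<in> I; j \<in> I; M i j = enat n\<rbrakk>
    \<Longrightarrow> word_eq I M (u @ concat (replicate n [i, j]) @ v) (u @ v)"

definition word_class :: "'i set \<Rightarrow> ('i \<Rightarrow> 'i \<Rightarrow> enat) \<Rightarrow> 'i list \<Rightarrow> 'i list set" where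
  "word_class I M u = {v. word_eq I M u v}"

definition coxeter_group :: "'i set \<Rightarrow> ('i \<Rightarrow> 'i \<Rightarrow> enat) \<Rightarrow> 'i list set monoid" where
  "coxeter_group I M =
     \<lparr>carrier = word_class I M ` lists I,
      mult = (\<lambda>X Y. \<Union>u\<in>X. \<Union>v\<in>Y. word_class I M (u @ v)),
      one = word_class I M []\<rparr>"

definition coxeter_length :: "'i set \<Rightarrow> ('i \<Rightarrow> 'i \<Rightarrow> enat) \<Rightarrow> 'i list set \<Rightarrow> nat" where
  "coxeter_length I M w = (LEAST n. \<exists>u\<in>lists I. length u = n \<and> word_class I M u = w)"

definition reduced :: "'i set \<Rightarrow> ('i \<Rightarrow> 'i \<Rightarrow> enat) \<Rightarrow> 'i list \<Rightarrow> bool" where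
  "reduced I M u \<longleftrightarrow> u \<in> lists I \<and> coxeter_length I M (word_class I M u) = length u"

lemma word_eq_lists: "word_eq I M u v \<Longrightarrow> u \<in> lists I \<and> v \<in> lists I"
proof (induction rule: word_eq.induct)
  case (relator u v i j n)
  have "concat (replicate n [i, j]) \<in> lists I"
    using \<open>i \<in> I\<close> \<open>j \<in> I\<close> by (induct n) simp_all
  with relator show ?case by simp
qed simp_all

lemma word_eq_append_left:
  "word_eq I M u v \<Longrightarrow> w \<in> lists I \<Longrightarrow> word_eq I M (w @ u) (w @ v)"
proof (induction rule: word_eq.induct)
  case (relator u v i j n)
  then show ?case using word_eq.relator[of "w @ u" I v i j M n] by simp
qed (simp_all add: word_eq.refl word_eq.sym, blast intro: word_eq.trans)

lemma word_eq_append_right: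
  "word_eq I M u v \<Longrightarrow> w \<in> lists I \<Longrightarrow> word_eq I M (u @ w) (v @ w)"
proof (induction rule: word_eq.induct)
  case (relator u v i j n)
  then show ?case using word_eq.relator[of u I "v @ w" i j M n] by simp
qed (simp_all add: word_eq.refl word_eq.sym, blast intro: word_eq.trans)

lemma word_class_eq_iff:
  "u \<in> lists I \<Longrightarrow> word_class I M u = word_class I M v \<longleftrightarrow> word_eq I M u v"
proof
  assume u: "u \<in> lists I" and "word_class I M u = word_class I M v"
  then have "word_eq I M v u"
    using word_eq.refl[OF u, of M] by (auto simp: word_class_def)
  then show "word_eq I M u v" by (rule word_eq.sym)
next
  assume uv: "word_eq I M u v"
  then have vu: "word_eq I M v u" by (rule word_eq.sym)
  have "word_eq I M u w \<longleftrightarrow> word_eq I M v w" for w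
    using word_eq.trans[OF vu, of w] word_eq.trans[OF uv, of w] by (rule iffI)
  then show "word_class I M u = word_class I M v"
    by (simp only: word_class_def)
qed

lemma coxeter_group_mult:
  assumes "u \<in> lists I" "v \<in> lists I"
  shows "word_class I M u \<otimes>\<^bsub>coxeter_group I M\<^esub> word_class I M v = word_class I M (u @ v)"
proof -
  have "word_class I M (u' @ v') = word_class I M (u @ v)"
    if "u' \<in> word_class I M u" "v' \<in> word_class I M v" for u' v'
  proof -
    have e: "word_eq I M u u'" "word_eq I M v v'"
      using that by (auto simp: word_class_def)
    have "word_eq I M (u @ v) (u' @ v')"
      using word_eq_append_right[OF e(1) assms(2)]
        word_eq_append_left[OF e(2), of u'] word_eq_lists[OF e(1)] by (blast intro: word_eq.trans)
    then show ?thesis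
      using word_class_eq_iff[of "u @ v" I M "u' @ v'"] assms by simp
  qed
  then have "(\<Union>u'\<in>word_class I M u. \<Union>v'\<in>word_class I M v. word_class I M (u' @ v')) =
      (\<Union>u'\<in>word_class I M u. \<Union>v'\<in>word_class I M v. word_class I M (u @ v))"
    by (intro SUP_cong HOL.refl) blast
  moreover have "word_class I M u \<noteq> {}" "word_class I M v \<noteq> {}"
    using word_eq.refl[OF assms(1)] word_eq.refl[OF assms(2)] unfolding word_class_def by blast+
  ultimately show ?thesis
    by (simp add: coxeter_group_def)
qed

lemma word_eq_rev:
  assumes "coxeter_matrix I M" "u \<in> lists I"
  shows "word_eq I M (rev u @ u) []"
  using assms(2)
proof (induction u)
  case Nil
  then show ?case by (simp add: word_eq.refl)
next
  case (Cons i u)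
  then have i: "i \<in> I" and u: "u \<in> lists I" by auto
  have "M i i = enat 1" using assms(1) i by (simp add: coxeter_matrix_def one_enat_def)
  then have "word_eq I M (rev u @ [i, i] @ u) (rev u @ u)"
    using word_eq.relator[of "rev u" I u i i M 1] i u by (simp add: in_lists_conv_set)
  then have "word_eq I M (rev u @ [i, i] @ u) []" using Cons.IH u by (blast intro: word_eq.trans)
  then show ?case by simp
qed

lemma group_coxeter_group:
  assumes "coxeter_matrix I M"
  shows "group (coxeter_group I M)"
proof (rule groupI)
  let ?W = "coxeter_group I M"
  have car: "carrier ?W = word_class I M ` lists I" and one: "\<one>\<^bsub>?W\<^esub> = word_class I M []"
    by (simp_all add: coxeter_group_def)
  note mult = coxeter_group_mult[where I = I and M = M]
  show "\<one>\<^bsub>?W\<^esub> \<in> carrier ?W" using imageI[of "[]" "lists I" "word_class I M"] unfolding car one by simp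
  show "x \<otimes>\<^bsub>?W\<^esub> y \<in> carrier ?W" if xy: "x \<in> carrier ?W" "y \<in> carrier ?W" for x y
  proof -
    obtain u v where "u \<in> lists I" "x = word_class I M u" "v \<in> lists I" "y = word_class I M v"
      using xy unfolding car by blast
    then show ?thesis unfolding car by (simp add: mult del: in_lists_conv_set)
  qed
  show "x \<otimes>\<^bsub>?W\<^esub> y \<otimes>\<^bsub>?W\<^esub> z = x \<otimes>\<^bsub>?W\<^esub> (y \<otimes>\<^bsub>?W\<^esub> z)"
    if xyz: "x \<in> carrier ?W" "y \<in> carrier ?W" "z \<in> carrier ?W" for x y z
  proof -
    obtain u v w where "u \<in> lists I" "x = word_class I M u" "v \<in> lists I" "y = word_class I M v"
      "w \<in> lists I" "z = word_class I M w"
      using xyz unfolding car by blast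
    then show ?thesis by (simp add: mult del: in_lists_conv_set)
  qed
  show "\<one>\<^bsub>?W\<^esub> \<otimes>\<^bsub>?W\<^esub> x = x" if x: "x \<in> carrier ?W" for x
  proof -
    obtain u where "u \<in> lists I" "x = word_class I M u"
      using x unfolding car by blast
    then show ?thesis by (simp add: one mult del: in_lists_conv_set)
  qed
  show "\<exists>y\<in>carrier ?W. y \<otimes>\<^bsub>?W\<^esub> x = \<one>\<^bsub>?W\<^esub>" if x: "x \<in> carrier ?W" for x
  proof -
    obtain u where u: "u \<in> lists I" "x = word_class I M u" using x unfolding car by blast
    have r: "rev u \<in> lists I" using u by (simp add: in_lists_conv_set)
    have "word_class I M (rev u) \<otimes>\<^bsub>?W\<^esub> x = \<one>\<^bsub>?W\<^esub>"
      using word_eq_rev[OF assms u(1)] word_class_eq_iff[of "rev u @ u" I M "[]"] r u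
      by (simp add: mult one del: in_lists_conv_set)
    then show ?thesis using r car by blast
  qed
qed

section \<open>Buildings and apartments\<close>

record ('c, 'i, 'w) coloured_graph =
  chambers :: "'c set"
  edges :: "'c set set"
  colour :: "'c set \<Rightarrow> 'i"
  wdist :: "'c \<Rightarrow> 'c \<Rightarrow> 'w"

definition simplicial_graph :: "'c set \<Rightarrow> 'c set set \<Rightarrow> bool" where
  "simplicial_graph V E \<longleftrightarrow> (\<forall>e\<in>E. e \<subseteq> V \<and> card e = 2)"

definition adjacent :: "('c, 'i, 'w) coloured_graph \<Rightarrow> 'i \<Rightarrow> 'c \<Rightarrow> 'c \<Rightarrow> bool" where
  "adjacent B i a b \<longleftrightarrow> {a, b} \<in> edges B \<and> colour B {a, b} = i"

definition gallery :: "('c, 'i, 'w) coloured_graph \<Rightarrow> 'i list \<Rightarrow> 'c list \<Rightarrow> bool" where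
  "gallery B u cs \<longleftrightarrow> length cs = Suc (length u) \<and> set cs \<subseteq> chambers B \<and>
     (\<forall>s<length u. adjacent B (u ! s) (cs ! s) (cs ! Suc s))"

definition building ::
  "'i set \<Rightarrow> ('i \<Rightarrow> 'i \<Rightarrow> enat) \<Rightarrow> ('c, 'i, 'i list set) coloured_graph \<Rightarrow> bool" where
  "building I M B \<longleftrightarrow>
     coxeter_matrix I M \<and>
     simplicial_graph (chambers B) (edges B) \<and>
     colour B \<in> edges B \<rightarrow> I \<and>
     (\<forall>a\<in>chambers B. \<forall>b\<in>chambers B. wdist B a b \<in> carrier (coxeter_group I M)) \<and>
     \<comment> \<open>(B1)\<close>
     (\<forall>a\<in>chambers B. \<forall>i\<in>I.
        (\<exists>b\<in>chambers B. adjacent B i a b) \<and>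
        (\<forall>b c. adjacent B i a b \<and> adjacent B i a c \<and> b \<noteq> c \<longrightarrow> adjacent B i b c)) \<and>
     \<comment> \<open>(B2)\<close>
     (\<forall>u. reduced I M u \<longrightarrow>
        (\<forall>a\<in>chambers B. \<forall>b\<in>chambers B.
           wdist B a b = word_class I M u \<longleftrightarrow>
           (\<exists>cs. gallery B u cs \<and> hd cs = a \<and> last cs = b)))"

definition building_automorphism ::
  "('c, 'i, 'w) coloured_graph \<Rightarrow> ('c \<Rightarrow> 'c) \<Rightarrow> bool" where
  "building_automorphism B f \<longleftrightarrow>
     bij_betw f (chambers B) (chambers B) \<and>
     (\<forall>a\<in>chambers B. \<forall>b\<in>chambers B. {f a, f b} \<in> edges B \<longleftrightarrow> {a, b} \<in> edges B) \<and>
     (\<forall>e\<in>edges B. colour B (f ` e) = colour B e)"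

text \<open>
  A full subgraph is represented by its vertex set. Its Weyl distance \<open>d\<close> is not prescribed,
  but (B2) forces it to agree with \<^term>\<open>wdist B\<close> on \<open>A\<close>.
\<close>

definition full_subgraph ::
  "('c, 'i, 'w) coloured_graph \<Rightarrow> 'c set \<Rightarrow> ('c, 'i, 'w) coloured_graph" where
  "full_subgraph B A = B\<lparr>chambers := A, edges := {e \<in> edges B. e \<subseteq> A}\<rparr>"

definition subbuilding ::
  "'i set \<Rightarrow> ('i \<Rightarrow> 'i \<Rightarrow> enat) \<Rightarrow> ('c, 'i, 'i list set) coloured_graph \<Rightarrow> 'c set \<Rightarrow> bool" where
  "subbuilding I M B A \<longleftrightarrow>
     A \<subseteq> chambers B \<and> (\<exists>d. building I M ((full_subgraph B A)\<lparr>wdist := d\<rparr>))"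

definition thin :: "'i set \<Rightarrow> ('c, 'i, 'w) coloured_graph \<Rightarrow> bool" where
  "thin I B \<longleftrightarrow> (\<forall>a\<in>chambers B. \<forall>i\<in>I. \<exists>!b. b \<in> chambers B \<and> adjacent B i a b)"

definition apartment ::
  "'i set \<Rightarrow> ('i \<Rightarrow> 'i \<Rightarrow> enat) \<Rightarrow> ('c, 'i, 'i list set) coloured_graph \<Rightarrow> 'c set \<Rightarrow> bool" where
  "apartment I M B A \<longleftrightarrow> subbuilding I M B A \<and> thin I (full_subgraph B A)"

definition maximal_atlas ::
  "'i set \<Rightarrow> ('i \<Rightarrow> 'i \<Rightarrow> enat) \<Rightarrow> ('c, 'i, 'i list set) coloured_graph \<Rightarrow> 'c set set" where
  "maximal_atlas I M B = {A. apartment I M B A}"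

section \<open>Euclidean type\<close>

definition hyperplane :: "'v::euclidean_space set \<Rightarrow> bool" where
  "hyperplane h \<longleftrightarrow> (\<exists>a b. a \<noteq> 0 \<and> h = {x. a \<bullet> x = b})"

text \<open>\<^term>\<open>closest_point h x\<close> is the orthogonal projection of \<open>x\<close> to the hyperplane \<open>h\<close>.\<close>

definition reflection :: "'v::euclidean_space set \<Rightarrow> 'v \<Rightarrow> 'v" where
  "reflection h x = 2 *\<^sub>R closest_point h x - x"

definition reflection_group :: "'v::euclidean_space set set \<Rightarrow> ('v \<Rightarrow> 'v) monoid" where
  "reflection_group H = subgroup_generated (BijGroup UNIV) (reflection ` H)"

definition euclidean_arrangement :: "'v::euclidean_space set set \<Rightarrow> bool" where
  "euclidean_arrangement H \<longleftrightarrow>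
     (\<forall>h\<in>H. hyperplane h) \<and>
     locally_finite_in euclidean H \<and>
     (\<forall>w\<in>carrier (reflection_group H). \<forall>h\<in>H. w ` h \<in> H) \<and>
     (\<exists>K. compact K \<and> (\<Union>w\<in>carrier (reflection_group H). w ` K) = UNIV)"

definition fundamental_domain :: "('v::euclidean_space \<Rightarrow> 'v) monoid \<Rightarrow> 'v set \<Rightarrow> bool" where
  "fundamental_domain W P \<longleftrightarrow>
     closed P \<and> interior P \<noteq> {} \<and>
     (\<Union>w\<in>carrier W. w ` P) = UNIV \<and>
     (\<forall>w\<in>carrier W. w \<noteq> \<one>\<^bsub>W\<^esub> \<longrightarrow> interior P \<inter> interior (w ` P) = {})"

definition facet_reflections :: "'v::euclidean_space set \<Rightarrow> ('v \<Rightarrow> 'v) set" where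
  "facet_reflections P = {reflection (affine hull F) | F. F facet_of P}"

text \<open>
  The Coxeter system given by \<open>I\<close> and \<open>M\<close> is isomorphic, as a group with a distinguished set of
  generators, to the one coming from an arrangement of hyperplanes in \<open>'v\<close> and a fundamental
  polytope bounded by it. Types of class \<^class>\<open>euclidean_space\<close> have positive dimension; the
  0-dimensional euclidean space has no hyperplanes and yields precisely the Coxeter system with
  \<open>I = {}\<close>.
\<close>

definition euclidean_type ::
  "'v::euclidean_space itself \<Rightarrow> 'i set \<Rightarrow> ('i \<Rightarrow> 'i \<Rightarrow> enat) \<Rightarrow> bool" where
  "euclidean_type _ I M \<longleftrightarrow> coxeter_matrix I M \<and>
     (I = {} \<or>
      (\<exists>(H :: 'v set set) P \<phi>.
         euclidean_arrangement H \<and>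
         polytope P \<and> (\<forall>F. F facet_of P \<longrightarrow> affine hull F \<in> H) \<and>
         fundamental_domain (reflection_group H) P \<and>
         \<phi> \<in> iso (coxeter_group I M) (reflection_group H) \<and>
         bij_betw (\<lambda>i. \<phi> (word_class I M [i])) I (facet_reflections P)))"

definition euclidean_building ::
  "'v::euclidean_space itself \<Rightarrow> 'i set \<Rightarrow> ('i \<Rightarrow> 'i \<Rightarrow> enat) \<Rightarrow>
     ('c, 'i, 'i list set) coloured_graph \<Rightarrow> bool" where
  "euclidean_building V I M B \<longleftrightarrow> building I M B \<and> euclidean_type V I M"

section \<open>Group actions\<close>

definition topological_group :: "('g, 'z) monoid_scheme \<Rightarrow> 'g topology \<Rightarrow> bool" where
  "topological_group G T \<longleftrightarrow> group G \<and> topspace T = carrier G \<and> Hausdorff_space T \<and>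
     continuous_map (prod_topology T T) T (\<lambda>(g, h). g \<otimes>\<^bsub>G\<^esub> h) \<and>
     continuous_map T T (\<lambda>g. inv\<^bsub>G\<^esub> g)"

definition continuous_action ::
  "('g, 'z) monoid_scheme \<Rightarrow> 'g topology \<Rightarrow> 'x topology \<Rightarrow> ('g \<Rightarrow> 'x \<Rightarrow> 'x) \<Rightarrow> bool" where
  "continuous_action G T X \<phi> \<longleftrightarrow> group_action G (topspace X) \<phi> \<and>
     continuous_map (prod_topology T X) X (\<lambda>(g, x). \<phi> g x)"

text \<open>The library's \<^const>\<open>proper_map\<close> does not include continuity.\<close>

definition proper_action ::
  "('g, 'z) monoid_scheme \<Rightarrow> 'g topology \<Rightarrow> 'x topology \<Rightarrow> ('g \<Rightarrow> 'x \<Rightarrow> 'x) \<Rightarrow> bool" where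
  "proper_action G T X \<phi> \<longleftrightarrow> continuous_action G T X \<phi> \<and>
     proper_map (prod_topology T X) (prod_topology X X) (\<lambda>(g, x). (\<phi> g x, x))"

definition acts_by_automorphisms ::
  "('g, 'z) monoid_scheme \<Rightarrow> ('c, 'i, 'w) coloured_graph \<Rightarrow> ('g \<Rightarrow> 'c \<Rightarrow> 'c) \<Rightarrow> bool" where
  "acts_by_automorphisms G B \<phi> \<longleftrightarrow> group_action G (chambers B) \<phi> \<and>
     (\<forall>g\<in>carrier G. building_automorphism B (\<phi> g))"

definition weyl_transitive ::
  "('g, 'z) monoid_scheme \<Rightarrow> ('c, 'i, 'w) coloured_graph \<Rightarrow> ('g \<Rightarrow> 'c \<Rightarrow> 'c) \<Rightarrow> bool" where
  "weyl_transitive G B \<phi> \<longleftrightarrow>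
     (\<forall>a\<in>chambers B. \<forall>b\<in>chambers B. \<forall>a'\<in>chambers B. \<forall>b'\<in>chambers B.
        wdist B a b = wdist B a' b' \<longrightarrow> (\<exists>g\<in>carrier G. \<phi> g a = a' \<and> \<phi> g b = b'))"

definition strongly_transitive ::
  "('g, 'z) monoid_scheme \<Rightarrow> 'c set set \<Rightarrow> ('g \<Rightarrow> 'c \<Rightarrow> 'c) \<Rightarrow> bool" where
  "strongly_transitive G \<A> \<phi> \<longleftrightarrow>
     (\<forall>g\<in>carrier G. \<forall>A\<in>\<A>. \<phi> g ` A \<in> \<A>) \<and>
     (\<forall>A\<in>\<A>. \<forall>A'\<in>\<A>. \<forall>a\<in>A. \<forall>a'\<in>A'. \<exists>g\<in>carrier G. \<phi> g a = a' \<and> \<phi> g ` A = A')"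

end

theory Submission
  imports Defs
begin

text \<open>
  Write \<open>\<delta>\<close> for the Weyl distance. Every nonempty apartment is an isometric copy of \<open>W\<close>, and every
  isometric copy of \<open>W\<close> is an apartment (\<open>delta_in_apartment\<close>, \<open>isometric_image_apartment\<close>); an
  isometry from a nonempty subset of \<open>W\<close> to the chambers extends to all of \<open>W\<close>, so any two chambers lie in a
  common apartment (\<open>isometric_extend\<close>, \<open>apartment_through\<close>).

  From strong to Weyl transitivity: given \<open>\<delta> a b = \<delta> a' b'\<close>, move an apartment through \<open>a\<close> and \<open>b\<close>
  to one through \<open>a'\<close> and \<open>b'\<close> by some \<open>g\<close> with \<open>g a = a'\<close>. Then \<open>g b\<close> and \<open>b'\<close> are chambers of
  one apartment at the same distance from \<open>a'\<close>, hence equal.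

  From Weyl to strong transitivity: let \<open>f\<close> be the isometry from an apartment \<open>A\<close> to an apartment
  \<open>A'\<close> that sends \<open>a\<close> to \<open>a'\<close>. A group element that agrees with \<open>f\<close> on \<open>A\<close> is wanted. The action
  being proper, the elements sending \<open>a\<close> to \<open>a'\<close> form a compact set, and by the finite intersection
  property it suffices to find, for every finite \<open>F \<subseteq> A\<close>, an element that agrees with \<open>f\<close> on \<open>F\<close>
  (\<open>proper_discrete_action_interpolation\<close>). This is where the type has to be euclidean: \<open>A\<close> contains
  chambers \<open>p\<close> and \<open>q\<close> such that every chamber of \<open>F\<close> lies on a minimal gallery from \<open>p\<close> to \<open>q\<close>
  (\<open>finite_set_between\<close>). Weyl transitivity gives \<open>g\<close> with \<open>g p = f p\<close> and \<open>g q = f q\<close>, and since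
  a minimal gallery is determined by its ends and its type (\<open>between_unique\<close>), \<open>g\<close> agrees with \<open>f\<close>
  on \<open>F\<close>.

  To find \<open>p\<close> and \<open>q\<close>, the length of \<open>x\<^sup>-\<^sup>1y\<close> is identified with the number of walls between the
  chambers \<open>x\<close> and \<open>y\<close> of the euclidean space (\<open>length_eq_card_sep\<close>); then \<open>p\<close> and \<open>q\<close> are taken
  far out in the two directions of a line that is transverse to the finitely many walls near \<open>F\<close>.
\<close>

section \<open>Length in Coxeter groups\<close>

locale coxeter_system =
  fixes I :: "'i set" and M :: "'i \<Rightarrow> 'i \<Rightarrow> enat"
  assumes matrix: "coxeter_matrix I M"
begin

abbreviation W where "W \<equiv> coxeter_group I M"
abbreviation cls where "cls \<equiv> word_class I M"
abbreviation len where "len \<equiv> coxeter_length I M"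
abbreviation gen where "gen i \<equiv> cls [i]"

sublocale W: group W
  using group_coxeter_group[OF matrix] .

lemma carrier_W: "carrier W = cls ` lists I"
  and one_W: "\<one>\<^bsub>W\<^esub> = cls []"
  by (simp_all add: coxeter_group_def)

lemma cls_in_W [simp]: "u \<in> lists I \<Longrightarrow> cls u \<in> carrier W"
  by (auto simp: carrier_W)

lemma gen_in_W [simp]: "i \<in> I \<Longrightarrow> gen i \<in> carrier W"
  by simp

lemma cls_append:
  "u \<in> lists I \<Longrightarrow> v \<in> lists I \<Longrightarrow> cls (u @ v) = cls u \<otimes>\<^bsub>W\<^esub> cls v"
  by (rule coxeter_group_mult[symmetric])

lemma cls_Cons: "i \<in> I \<Longrightarrow> v \<in> lists I \<Longrightarrow> cls (i # v) = gen i \<otimes>\<^bsub>W\<^esub> cls v"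
  using cls_append[of "[i]" v] by simp

lemma gen_square: "i \<in> I \<Longrightarrow> gen i \<otimes>\<^bsub>W\<^esub> gen i = \<one>\<^bsub>W\<^esub>"
  using word_eq_rev[OF matrix, of "[i]"] word_class_eq_iff[of "[i, i]" I M "[]"]
  by (simp add: one_W flip: cls_append)

lemma inv_gen: "i \<in> I \<Longrightarrow> inv\<^bsub>W\<^esub> gen i = gen i"
  by (rule W.inv_equality) (simp_all add: gen_square)

lemma gen_cancel:
  assumes "w \<in> carrier W" "i \<in> I"
  shows "w \<otimes>\<^bsub>W\<^esub> gen i \<otimes>\<^bsub>W\<^esub> gen i = w" "gen i \<otimes>\<^bsub>W\<^esub> (gen i \<otimes>\<^bsub>W\<^esub> w) = w"
proof -
  have g: "gen i \<in> carrier W" using assms by simp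
  show "w \<otimes>\<^bsub>W\<^esub> gen i \<otimes>\<^bsub>W\<^esub> gen i = w"
    using W.m_assoc[OF assms(1) g g] gen_square[OF assms(2)] assms(1) by simp
  show "gen i \<otimes>\<^bsub>W\<^esub> (gen i \<otimes>\<^bsub>W\<^esub> w) = w"
    using W.m_assoc[OF g g assms(1)] gen_square[OF assms(2)] assms(1) by simp
qed

lemma inv_cls: "u \<in> lists I \<Longrightarrow> inv\<^bsub>W\<^esub> cls u = cls (rev u)"
proof (rule W.inv_equality)
  assume u: "u \<in> lists I"
  then have r: "rev u \<in> lists I" by (simp add: in_lists_conv_set)
  show "cls (rev u) \<otimes>\<^bsub>W\<^esub> cls u = \<one>\<^bsub>W\<^esub>"
    using word_eq_rev[OF matrix u] word_class_eq_iff[of "rev u @ u" I M "[]"] u r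
    by (simp add: one_W del: in_lists_conv_set flip: cls_append)
  show "cls (rev u) \<in> carrier W" using r by simp
qed simp_all

lemma reduced_word_exists:
  assumes "w \<in> carrier W"
  obtains u where "reduced I M u" "cls u = w" "length u = len w" "u \<in> lists I"
proof -
  have "\<exists>n. \<exists>u\<in>lists I. length u = n \<and> cls u = w"
    using assms by (auto simp: carrier_W)
  from LeastI_ex[OF this] obtain u where "u \<in> lists I" "length u = len w" "cls u = w"
    unfolding coxeter_length_def by blast
  then show thesis by (intro that) (simp_all add: reduced_def)
qed

lemma len_le: "u \<in> lists I \<Longrightarrow> len (cls u) \<le> length u"
  unfolding coxeter_length_def by (rule Least_le) auto

lemma len_one [simp]: "len \<one>\<^bsub>W\<^esub> = 0"
  using len_le[of "[]"] by (simp add: one_W)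

lemma reduced_Nil [simp]: "reduced I M []"
  using len_le[of "[]"] by (simp add: reduced_def)

lemma reduced_lists: "reduced I M u \<Longrightarrow> u \<in> lists I"
  by (simp add: reduced_def)

lemma len_mult_le:
  assumes "w \<in> carrier W" "z \<in> carrier W"
  shows "len (w \<otimes>\<^bsub>W\<^esub> z) \<le> len w + len z"
proof -
  obtain u where "cls u = w" "length u = len w" "u \<in> lists I"
    using reduced_word_exists[OF assms(1)] by metis
  moreover obtain v where "cls v = z" "length v = len z" "v \<in> lists I"
    using reduced_word_exists[OF assms(2)] by metis
  ultimately show ?thesis using len_le[of "u @ v"] cls_append[of u v] by simp
qed

lemma len_inv:
  assumes "w \<in> carrier W"
  shows "len (inv\<^bsub>W\<^esub> w) = len w"
proof -
  have le: "len (inv\<^bsub>W\<^esub> z) \<le> len z" if z: "z \<in> carrier W" for z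
  proof -
    obtain u where u: "cls u = z" "length u = len z" "u \<in> lists I"
      using reduced_word_exists[OF z] by metis
    then have "rev u \<in> lists I" by (simp add: in_lists_conv_set)
    then show ?thesis using len_le[of "rev u"] u inv_cls[OF u(3)] by simp
  qed
  show ?thesis using le[OF assms] le[of "inv\<^bsub>W\<^esub> w"] assms by simp
qed

text \<open>Every relator \<open>(ij)\<^sup>n\<close> has even length, so the parity of the number of letters is an
  invariant of the group element. Multiplying by a generator therefore always changes the length,
  by exactly one.\<close>

lemma word_eq_parity: "word_eq I M u v \<Longrightarrow> even (length u) \<longleftrightarrow> even (length v)"
proof (induction rule: word_eq.induct)
  case (relator u v i j n)
  have "length (concat (replicate n [i, j])) = 2 * n" by (induct n) simp_all
  then show ?case by simp
qed auto

lemma len_parity: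
  assumes "u \<in> lists I"
  shows "even (len (cls u)) \<longleftrightarrow> even (length u)"
proof -
  obtain v where v: "cls v = cls u" "length v = len (cls u)" "v \<in> lists I"
    using reduced_word_exists[OF cls_in_W[OF assms]] by metis
  have "word_eq I M v u" using word_class_eq_iff[OF v(3)] v(1) by simp
  from word_eq_parity[OF this] v(2) show ?thesis by simp
qed

lemma len_mult_gen_cases:
  assumes "w \<in> carrier W" "i \<in> I"
  obtains "len (w \<otimes>\<^bsub>W\<^esub> gen i) = Suc (len w)" | "len w = Suc (len (w \<otimes>\<^bsub>W\<^esub> gen i))"
proof -
  obtain u where u: "cls u = w" "length u = len w" "u \<in> lists I"
    using reduced_word_exists[OF assms(1)] by metis
  have p: "even (len (w \<otimes>\<^bsub>W\<^esub> gen i)) \<longleftrightarrow> odd (len w)"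
    using len_parity[of "u @ [i]"] cls_append[of u "[i]"] u assms by simp
  have g: "len (gen i) \<le> 1" using len_le[of "[i]"] assms by simp
  have "len (w \<otimes>\<^bsub>W\<^esub> gen i) \<le> Suc (len w)"
    using len_mult_le[OF assms(1), of "gen i"] g assms by simp
  moreover have "len w \<le> Suc (len (w \<otimes>\<^bsub>W\<^esub> gen i))"
    using len_mult_le[of "w \<otimes>\<^bsub>W\<^esub> gen i" "gen i"] g assms gen_cancel(1)[OF assms] by simp
  moreover have "len (w \<otimes>\<^bsub>W\<^esub> gen i) \<noteq> len w"
  proof
    assume "len (w \<otimes>\<^bsub>W\<^esub> gen i) = len w"
    with p show False by simp
  qed
  ultimately show thesis using that by linarith
qed

lemma len_gen [simp]: "i \<in> I \<Longrightarrow> len (gen i) = 1"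
  by (rule len_mult_gen_cases[of "\<one>\<^bsub>W\<^esub>" i]) simp_all

lemma reduced_singleton [simp]: "i \<in> I \<Longrightarrow> reduced I M [i]"
  by (simp add: reduced_def)

lemma mult_gen_ne: "w \<in> carrier W \<Longrightarrow> i \<in> I \<Longrightarrow> w \<otimes>\<^bsub>W\<^esub> gen i \<noteq> w"
  by (rule len_mult_gen_cases[of w i]) auto

lemma reduced_snoc:
  assumes "reduced I M u" "i \<in> I" "len (cls u \<otimes>\<^bsub>W\<^esub> gen i) = Suc (len (cls u))"
  shows "reduced I M (u @ [i])"
  using assms cls_append[of u "[i]"] by (simp add: reduced_def)

lemma reduced_append:
  assumes "reduced I M u" "reduced I M v"
    and "len (cls u \<otimes>\<^bsub>W\<^esub> cls v) = len (cls u) + len (cls v)"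
  shows "reduced I M (u @ v)"
  using assms cls_append[of u v] by (simp add: reduced_def)

lemma reduced_prefix:
  assumes "reduced I M (u @ v)"
  shows "reduced I M u"
proof -
  have uv: "u \<in> lists I" "v \<in> lists I" using reduced_lists[OF assms] by auto
  have "length u + length v \<le> len (cls u) + len (cls v)"
    using assms len_mult_le[of "cls u" "cls v"] uv by (simp add: reduced_def cls_append)
  then show ?thesis using len_le[OF uv(1)] len_le[OF uv(2)] uv by (simp add: reduced_def)
qed

lemma carrier_W_induct [consumes 1, case_names one mult]:
  assumes "w \<in> carrier W"
    and "P \<one>\<^bsub>W\<^esub>" and "\<And>w i. w \<in> carrier W \<Longrightarrow> i \<in> I \<Longrightarrow> P w \<Longrightarrow> P (w \<otimes>\<^bsub>W\<^esub> gen i)"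
  shows "P w"
proof -
  obtain u where u: "u \<in> lists I" "w = cls u" using assms(1) by (auto simp: carrier_W)
  have "P (cls u)" using u(1)
  proof (induction u rule: rev_induct)
    case Nil
    then show ?case using assms(2) by (simp add: one_W)
  next
    case (snoc i u)
    then show ?case using assms(3)[of "cls u" i] cls_append[of u "[i]"] by simp
  qed
  then show ?thesis by (simp add: u)
qed

end

section \<open>Galleries\<close>

text \<open>Existence of a gallery, by recursion on its type and thus ready for induction.\<close>

fun joined :: "('c, 'i, 'w) coloured_graph \<Rightarrow> 'i list \<Rightarrow> 'c \<Rightarrow> 'c \<Rightarrow> bool" where
  "joined B [] a b \<longleftrightarrow> a = b"
| "joined B (i # u) a b \<longleftrightarrow> (\<exists>c. adjacent B i a c \<and> joined B u c b)"

lemma adjacent_sym: "adjacent B i a b \<Longrightarrow> adjacent B i b a"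
  by (simp add: adjacent_def insert_commute)

lemma joined_append: "joined B (u @ v) a b \<longleftrightarrow> (\<exists>c. joined B u a c \<and> joined B v c b)"
  by (induction u arbitrary: a) auto

lemma joined_rev: "joined B (rev u) b a \<longleftrightarrow> joined B u a b"
proof (induction u arbitrary: a)
  case (Cons i u)
  have "joined B (rev (i # u)) b a \<longleftrightarrow> (\<exists>c. joined B u c b \<and> adjacent B i c a)"
    by (simp add: joined_append Cons.IH)
  also have "\<dots> \<longleftrightarrow> joined B (i # u) a b"
    using adjacent_sym[of B i] by auto
  finally show ?case .
qed auto

lemma gallery_Cons:
  "gallery B (i # u) cs \<longleftrightarrow> (\<exists>a ds. cs = a # ds \<and> a \<in> chambers B \<and> gallery B u ds \<and> adjacent B i a (hd ds))"
proof (cases cs)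
  case Nil
  then show ?thesis by (simp add: gallery_def)
next
  case (Cons a ds)
  show ?thesis
  proof (cases "length ds = Suc (length u)")
    case True
    then have "ds \<noteq> []" by auto
    then show ?thesis using Cons
      by (auto simp: gallery_def hd_conv_nth All_less_Suc2)
  next
    case False
    then show ?thesis using Cons by (auto simp: gallery_def)
  qed
qed

lemma adjacent_chambers:
  assumes "simplicial_graph (chambers B) (edges B)" "adjacent B i a b"
  shows "a \<in> chambers B" "b \<in> chambers B" "a \<noteq> b"
proof -
  have "{a, b} \<subseteq> chambers B" "card {a, b} = 2"
    using assms unfolding simplicial_graph_def adjacent_def by auto
  then show "a \<in> chambers B" "b \<in> chambers B" "a \<noteq> b" by auto
qed

lemma gallery_iff_joined:
  assumes "simplicial_graph (chambers B) (edges B)" "a \<in> chambers B"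
  shows "(\<exists>cs. gallery B u cs \<and> hd cs = a \<and> last cs = b) \<longleftrightarrow> joined B u a b"
  using assms(2)
proof (induction u arbitrary: a)
  case Nil
  then show ?case
    by (auto simp: gallery_def length_Suc_conv intro: exI[of _ "[b]"])
next
  case (Cons i u)
  show ?case
  proof
    assume "\<exists>cs. gallery B (i # u) cs \<and> hd cs = a \<and> last cs = b"
    then obtain ds where ds: "gallery B u ds" "adjacent B i a (hd ds)" "last (a # ds) = b"
      by (auto simp: gallery_Cons)
    then have "ds \<noteq> []" by (auto simp: gallery_def)
    then have "joined B u (hd ds) b"
      using ds Cons.IH[OF adjacent_chambers(2)[OF assms(1) ds(2)]] by auto
    then show "joined B (i # u) a b" using ds by auto
  next
    assume "joined B (i # u) a b"
    then obtain c where c: "adjacent B i a c" "joined B u c b" by auto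
    then obtain ds where ds: "gallery B u ds" "hd ds = c" "last ds = b"
      using Cons.IH[OF adjacent_chambers(2)[OF assms(1) c(1)]] by auto
    then have "ds \<noteq> []" by (auto simp: gallery_def)
    then show "\<exists>cs. gallery B (i # u) cs \<and> hd cs = a \<and> last cs = b"
      using ds c Cons.prems by (intro exI[of _ "a # ds"]) (auto simp: gallery_Cons)
  qed
qed

section \<open>The Weyl distance\<close>

locale building_of_type = coxeter_system I M
  for I :: "'i set" and M :: "'i \<Rightarrow> 'i \<Rightarrow> enat" +
  fixes B :: "('c, 'i, 'i list set) coloured_graph"
  assumes building: "building I M B"
begin

abbreviation C where "C \<equiv> chambers B"
abbreviation \<delta> where "\<delta> \<equiv> wdist B"
abbreviation adj where "adj \<equiv> adjacent B"

lemma graph: "simplicial_graph C (edges B)"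
  using building unfolding building_def by (elim conjE)

lemma colour_I: "colour B \<in> edges B \<rightarrow> I"
  using building unfolding building_def by (elim conjE)

lemma delta_in_W: "\<forall>a\<in>C. \<forall>b\<in>C. \<delta> a b \<in> carrier W"
  using building unfolding building_def by (elim conjE)

lemma B1: "\<forall>a\<in>C. \<forall>i\<in>I. (\<exists>b\<in>C. adj i a b) \<and>
    (\<forall>b c. adj i a b \<and> adj i a c \<and> b \<noteq> c \<longrightarrow> adj i b c)"
  using building unfolding building_def by (elim conjE)

lemma B2: "\<forall>u. reduced I M u \<longrightarrow> (\<forall>a\<in>C. \<forall>b\<in>C.
    \<delta> a b = cls u \<longleftrightarrow> (\<exists>cs. gallery B u cs \<and> hd cs = a \<and> last cs = b))"
  using building unfolding building_def by (elim conjE)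

lemma adj_I: "adj i a b \<Longrightarrow> i \<in> I"
  using colour_I by (auto simp: adjacent_def)

lemmas adj_C = adjacent_chambers[OF graph]

lemma adj_exists: "a \<in> C \<Longrightarrow> i \<in> I \<Longrightarrow> \<exists>b. adj i a b"
  using B1 by blast

lemma adj_trans:
  assumes "adj i a b" "adj i b c" "a \<noteq> c"
  shows "adj i a c"
proof -
  have "b \<in> C" "i \<in> I" using adj_C(2)[OF assms(1)] adj_I[OF assms(1)] by auto
  then show ?thesis using B1 adjacent_sym[OF assms(1)] assms(2,3) by blast
qed

lemma delta_W [simp]: "a \<in> C \<Longrightarrow> b \<in> C \<Longrightarrow> \<delta> a b \<in> carrier W"
  using delta_in_W by blast

lemma delta_iff_joined:
  assumes "reduced I M u" "a \<in> C" "b \<in> C"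
  shows "\<delta> a b = cls u \<longleftrightarrow> joined B u a b"
  using B2[rule_format, OF assms] gallery_iff_joined[OF graph assms(2), of u b] by (rule HOL.trans)

lemma joined_C: "joined B u a b \<Longrightarrow> a \<in> C \<Longrightarrow> b \<in> C"
  by (induction u arbitrary: a) (auto dest: adj_C)

lemma joined_I: "joined B u a b \<Longrightarrow> u \<in> lists I"
  by (induction u arbitrary: a) (auto dest: adj_I)

lemma joined_delta: "reduced I M u \<Longrightarrow> a \<in> C \<Longrightarrow> joined B u a b \<Longrightarrow> \<delta> a b = cls u"
  using delta_iff_joined[of u a b] joined_C[of u a b] by blast

lemma delta_reduced_gallery:
  assumes "a \<in> C" "b \<in> C"
  obtains u where "reduced I M u" "cls u = \<delta> a b" "length u = len (\<delta> a b)" "joined B u a b"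
proof -
  obtain u where u: "reduced I M u" "cls u = \<delta> a b" "length u = len (\<delta> a b)"
    using reduced_word_exists[OF delta_W[OF assms]] .
  then have "joined B u a b" using delta_iff_joined[OF u(1) assms] by simp
  with u show thesis by (rule that)
qed

lemma delta_one: "a \<in> C \<Longrightarrow> b \<in> C \<Longrightarrow> \<delta> a b = \<one>\<^bsub>W\<^esub> \<longleftrightarrow> a = b"
  using delta_iff_joined[of "[]" a b] by (simp add: one_W)

lemma delta_gen: "a \<in> C \<Longrightarrow> b \<in> C \<Longrightarrow> i \<in> I \<Longrightarrow> \<delta> a b = gen i \<longleftrightarrow> adj i a b"
  using delta_iff_joined[of "[i]" a b] by simp

lemma delta_inv:
  assumes "a \<in> C" "b \<in> C"
  shows "\<delta> b a = inv\<^bsub>W\<^esub> \<delta> a b"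
proof -
  obtain u where u: "reduced I M u" "cls u = \<delta> a b" "joined B u a b"
    using delta_reduced_gallery[OF assms] .
  have U: "u \<in> lists I" using u(1) by (rule reduced_lists)
  have "reduced I M (rev u)"
    using u(1) U len_inv[of "cls u"] by (simp add: reduced_def inv_cls in_lists_conv_set del: lists.simps)
  then have "\<delta> b a = cls (rev u)"
    using u(3) assms by (intro joined_delta) (simp_all add: joined_rev)
  then show ?thesis using inv_cls[OF U] u by simp
qed

lemma delta_step_up:
  assumes "a \<in> C" "b \<in> C" "adj i b c"
    and "len (\<delta> a b \<otimes>\<^bsub>W\<^esub> gen i) = Suc (len (\<delta> a b))"
  shows "\<delta> a c = \<delta> a b \<otimes>\<^bsub>W\<^esub> gen i"
proof -
  have i: "i \<in> I" using assms adj_I by simp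
  obtain u where u: "reduced I M u" "cls u = \<delta> a b" "joined B u a b"
    using delta_reduced_gallery[OF assms(1,2)] .
  have "\<delta> a c = cls (u @ [i])"
  proof (rule joined_delta)
    show "reduced I M (u @ [i])" using u i assms(4) by (intro reduced_snoc) simp_all
    show "joined B (u @ [i]) a c" using u(3) assms(3) by (auto simp: joined_append)
  qed fact
  then show ?thesis using u reduced_lists[OF u(1)] i cls_append[of u "[i]"] by simp
qed

lemma gate_exists:
  assumes "a \<in> C" "b \<in> C" "i \<in> I" and "len (\<delta> a b) = Suc (len (\<delta> a b \<otimes>\<^bsub>W\<^esub> gen i))"
  obtains p where "adj i b p" "\<delta> a p = \<delta> a b \<otimes>\<^bsub>W\<^esub> gen i"
proof -
  define w where "w = \<delta> a b \<otimes>\<^bsub>W\<^esub> gen i"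
  have w: "w \<in> carrier W" "w \<otimes>\<^bsub>W\<^esub> gen i = \<delta> a b"
    using assms by (simp_all add: w_def gen_cancel)
  obtain u where u: "reduced I M u" "cls u = w" using reduced_word_exists[OF w(1)] .
  have U: "u \<in> lists I" using u(1) by (rule reduced_lists)
  have r: "reduced I M (u @ [i])"
    using u w assms by (intro reduced_snoc) (simp_all add: w_def)
  have "\<delta> a b = cls (u @ [i])" using u w U assms(3) cls_append[of u "[i]"] by simp
  then have "joined B (u @ [i]) a b" using delta_iff_joined[OF r assms(1,2)] by simp
  then obtain p where p: "joined B u a p" "adj i p b" by (auto simp: joined_append)
  show thesis
  proof (rule that)
    show "adj i b p" using p(2) by (rule adjacent_sym)
    show "\<delta> a p = \<delta> a b \<otimes>\<^bsub>W\<^esub> gen i"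
      using joined_delta[OF u(1) assms(1) p(1)] u(2) by (simp add: w_def)
  qed
qed

text \<open>When multiplication by \<open>i\<close> shortens \<open>\<delta> a b\<close>, a minimal gallery to \<open>b\<close> enters the \<open>i\<close>-panel of \<open>b\<close>
  at a chamber \<open>p\<close> nearer to \<open>a\<close>. Either \<open>c\<close> is \<open>p\<close>, or \<open>c\<close> is adjacent to \<open>p\<close> and then as far from \<open>a\<close>
  as \<open>b\<close>.\<close>

lemma delta_step:
  assumes "a \<in> C" "b \<in> C" "adj i b c"
  shows "\<delta> a c = \<delta> a b \<or> \<delta> a c = \<delta> a b \<otimes>\<^bsub>W\<^esub> gen i"
proof -
  have i: "i \<in> I" using assms adj_I by simp
  show ?thesis
  proof (rule len_mult_gen_cases[OF delta_W[OF assms(1,2)] i])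
    assume "len (\<delta> a b \<otimes>\<^bsub>W\<^esub> gen i) = Suc (len (\<delta> a b))"
    then show ?thesis using delta_step_up[OF assms] by simp
  next
    assume down: "len (\<delta> a b) = Suc (len (\<delta> a b \<otimes>\<^bsub>W\<^esub> gen i))"
    obtain p where p: "adj i b p" "\<delta> a p = \<delta> a b \<otimes>\<^bsub>W\<^esub> gen i"
      using gate_exists[OF assms(1,2) i down] .
    show ?thesis
    proof (cases "c = p")
      case False
      have "adj i p c" using adj_trans[OF adjacent_sym[OF p(1)] assms(3)] False by simp
      then have "\<delta> a c = \<delta> a p \<otimes>\<^bsub>W\<^esub> gen i"
        using p down assms i adj_C(2)[OF p(1)] by (intro delta_step_up) (simp_all add: gen_cancel)
      then show ?thesis using p assms i by (simp add: gen_cancel)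
    qed (use p in simp)
  qed
qed

text \<open>A gallery of arbitrary type may stutter, which only drops letters from its type.\<close>

lemma delta_along_gallery:
  assumes "a \<in> C" "b \<in> C" "joined B v b c"
  shows "\<exists>z\<in>carrier W. len z \<le> length v \<and> \<delta> a c = \<delta> a b \<otimes>\<^bsub>W\<^esub> z"
  using assms(2,3)
proof (induction v arbitrary: b)
  case Nil
  then show ?case using assms(1) by (auto intro!: bexI[of _ "\<one>\<^bsub>W\<^esub>"])
next
  case (Cons i v)
  then obtain d where d: "adj i b d" "joined B v d c" by auto
  have i: "i \<in> I" and D: "d \<in> C" using d adj_I adj_C by auto
  from Cons.IH[OF D d(2)] obtain z
    where z: "z \<in> carrier W" "len z \<le> length v" "\<delta> a c = \<delta> a d \<otimes>\<^bsub>W\<^esub> z" by blast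
  from delta_step[OF assms(1) Cons.prems(1) d(1)] show ?case
  proof
    assume "\<delta> a d = \<delta> a b"
    then show ?thesis using z by (auto intro!: bexI[of _ z])
  next
    assume "\<delta> a d = \<delta> a b \<otimes>\<^bsub>W\<^esub> gen i"
    then have "\<delta> a c = \<delta> a b \<otimes>\<^bsub>W\<^esub> (gen i \<otimes>\<^bsub>W\<^esub> z)"
      using z i assms(1) Cons.prems(1) by (simp add: W.m_assoc)
    moreover have "len (gen i \<otimes>\<^bsub>W\<^esub> z) \<le> Suc (length v)"
      using len_mult_le[of "gen i" z] z i by simp
    ultimately show ?thesis using z i by (auto intro!: bexI[of _ "gen i \<otimes>\<^bsub>W\<^esub> z"])
  qed
qed

text \<open>A reduced gallery is determined by its type and its two ends: the last but one chambers of two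
  such galleries lie in one panel and at the same distance from the start, and if they were
  different, then the step from one to the other would lengthen the distance. Hence a chamber between \<open>P\<close> and
  \<open>Q\<close> is determined by its distances from \<open>P\<close> and to \<open>Q\<close>.\<close>

lemma between_unique:
  assumes "P \<in> C" "X \<in> C" "Y \<in> C" "Q \<in> C"
    and "\<delta> P X = \<delta> P Y" "\<delta> X Q = \<delta> Y Q"
    and "len (\<delta> P X \<otimes>\<^bsub>W\<^esub> \<delta> X Q) = len (\<delta> P X) + len (\<delta> X Q)"
  shows "X = Y"
proof -
  have *: "X = Y" if "reduced I M (u @ v)" "reduced I M u" "\<delta> P X = cls u" "\<delta> P Y = cls u"
    "joined B v X Q" "joined B v Y Q" "Q \<in> C" for u v Q
    using that
  proof (induction v arbitrary: Q rule: rev_induct)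
    case Nil
    then show ?case by simp
  next
    case (snoc i v)
    from snoc.prems obtain Z where Z: "joined B v X Z" "adj i Z Q" by (auto simp: joined_append)
    from snoc.prems obtain Z' where Z': "joined B v Y Z'" "adj i Z' Q" by (auto simp: joined_append)
    have r: "reduced I M (u @ v)" using reduced_prefix[of "u @ v" "[i]"] snoc.prems(1) by simp
    have ZC: "Z \<in> C" "Z' \<in> C" and i: "i \<in> I" using Z(2) Z'(2) adj_C adj_I by auto
    have uX: "joined B u P X" "joined B u P Y"
      using delta_iff_joined[OF snoc.prems(2) assms(1,2)] snoc.prems(3)
        delta_iff_joined[OF snoc.prems(2) assms(1,3)] snoc.prems(4) by blast+
    have dZ: "\<delta> P Z = cls (u @ v)" "\<delta> P Z' = cls (u @ v)"
      using uX Z(1) Z'(1) assms by (auto intro!: joined_delta[OF r] simp: joined_append)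
    have "Z = Z'"
    proof (rule ccontr)
      assume "Z \<noteq> Z'"
      then have a: "adj i Z Z'" using adj_trans[OF Z(2) adjacent_sym[OF Z'(2)]] by simp
      have uv: "u @ v \<in> lists I" using r by (rule reduced_lists)
      have "cls (u @ v @ [i]) = cls (u @ v) \<otimes>\<^bsub>W\<^esub> gen i"
        using cls_append[of "u @ v" "[i]"] uv i by simp
      then have "len (cls (u @ v) \<otimes>\<^bsub>W\<^esub> gen i) = Suc (len (cls (u @ v)))"
        using r snoc.prems(1) by (simp add: reduced_def)
      then have "\<delta> P Z' = cls (u @ v) \<otimes>\<^bsub>W\<^esub> gen i"
        using delta_step_up[OF assms(1) ZC(1) a] dZ by simp
      then show False using dZ mult_gen_ne[of "cls (u @ v)" i] uv i by simp
    qed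
    then show ?case using snoc.IH[OF r snoc.prems(2-4) Z(1) _ ZC(1)] Z'(1) by simp
  qed
  obtain u where u: "reduced I M u" "cls u = \<delta> P X"
    using delta_reduced_gallery[OF assms(1,2)] .
  obtain v where v: "reduced I M v" "cls v = \<delta> X Q" "joined B v X Q"
    using delta_reduced_gallery[OF assms(2,4)] .
  have "reduced I M (u @ v)" using u v assms by (intro reduced_append) simp_all
  moreover have "joined B v Y Q" using delta_iff_joined[OF v(1) assms(3,4)] v(2) assms(6) by simp
  ultimately show ?thesis using *[OF _ u(1) u(2)[symmetric] _ v(3) _ assms(4)] u(2) assms(5) by simp
qed

end

section \<open>Hyperplanes and reflections\<close>

lemma hyperplaneE:
  assumes "hyperplane h"
  obtains a b where "a \<noteq> 0" "h = {x. a \<bullet> x = b}"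
  using assms unfolding hyperplane_def by blast

lemma reflection_formula:
  fixes a x :: "'v::euclidean_space"
  assumes "a \<noteq> 0"
  shows "reflection {y. a \<bullet> y = b} x = x - (2 * ((a \<bullet> x - b) / (a \<bullet> a))) *\<^sub>R a"
proof -
  define p where "p = x - ((a \<bullet> x - b) / (a \<bullet> a)) *\<^sub>R a"
  have p: "a \<bullet> p = b" using assms by (simp add: p_def inner_diff_right)
  have "dist x p \<le> dist x z" if z: "a \<bullet> z = b" for z
  proof -
    have "norm a * dist x p = \<bar>a \<bullet> x - b\<bar>"
      using assms by (simp add: p_def dist_norm dot_square_norm power2_eq_square)
    also have "\<dots> = \<bar>a \<bullet> (x - z)\<bar>" using z by (simp add: inner_diff_right)
    also have "\<dots> \<le> norm a * dist x z" unfolding dist_norm by (rule Cauchy_Schwarz_ineq2)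
    finally show ?thesis using assms by simp
  qed
  then have "p = closest_point {y. a \<bullet> y = b} x"
    using p by (intro closest_point_unique) (auto intro: convex_hyperplane closed_hyperplane)
  then have "reflection {y. a \<bullet> y = b} x = 2 *\<^sub>R p - x" by (simp add: reflection_def)
  moreover have "2 *\<^sub>R (x - k *\<^sub>R a) - x = x - (2 * k) *\<^sub>R a" for k
    using scaleR_2[of x] by (simp add: scaleR_diff_right)
  ultimately show ?thesis by (simp add: p_def)
qed

lemma reflection_fixes: "x \<in> h \<Longrightarrow> reflection h x = x"
  by (simp add: reflection_def closest_point_self scaleR_2)

text \<open>What an isometry needs to transport segments and open sets.\<close>

definition affine_bij :: "('v::euclidean_space \<Rightarrow> 'v) \<Rightarrow> bool" where
  "affine_bij f \<longleftrightarrow> bij f \<and> continuous_on UNIV f \<and>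
     (\<forall>x y t. f ((1 - t) *\<^sub>R x + t *\<^sub>R y) = (1 - t) *\<^sub>R f x + t *\<^sub>R f y)"

lemma affine_bij_comp:
  assumes "affine_bij f" "affine_bij g"
  shows "affine_bij (f \<circ> g)"
  unfolding affine_bij_def
proof (intro conjI allI)
  show "bij (f \<circ> g)" using assms by (intro bij_comp) (simp_all add: affine_bij_def)
  show "continuous_on UNIV (f \<circ> g)"
    using assms by (intro continuous_on_compose) (auto simp: affine_bij_def intro: continuous_on_subset)
qed (use assms in \<open>simp add: affine_bij_def\<close>)

lemma affine_bij_segment:
  "affine_bij f \<Longrightarrow> f ` closed_segment x y = closed_segment (f x) (f y)"
  by (simp add: closed_segment_image_interval image_image affine_bij_def)

lemma reflection_involution:
  fixes h :: "'v::euclidean_space set"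
  assumes "hyperplane h"
  shows "reflection h (reflection h x) = x"
proof -
  obtain a b where ab: "a \<noteq> 0" "h = {x. a \<bullet> x = b}" using hyperplaneE[OF assms] .
  note f = reflection_formula[OF ab(1), of b, folded ab(2)]
  have "a \<bullet> reflection h x - b = - (a \<bullet> x - b)"
    using ab(1) unfolding f by (simp add: inner_diff_right)
  then have "reflection h (reflection h x) = reflection h x - (2 * (- (a \<bullet> x - b) / (a \<bullet> a))) *\<^sub>R a"
    using f[of "reflection h x"] by presburger
  also have "\<dots> = reflection h x + (2 * ((a \<bullet> x - b) / (a \<bullet> a))) *\<^sub>R a"
    by (simp only: minus_divide_left[symmetric] mult_minus_right scaleR_minus_left diff_minus_eq_add)
  also have "\<dots> = x" by (simp only: f diff_add_cancel)
  finally show ?thesis .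
qed

lemma affine_bij_reflection:
  assumes "hyperplane h"
  shows "affine_bij (reflection h)"
proof -
  obtain a b where ab: "a \<noteq> 0" "h = {x. a \<bullet> x = b}" using hyperplaneE[OF assms] .
  have f: "reflection h = (\<lambda>x. x - (2 * ((a \<bullet> x - b) / (a \<bullet> a))) *\<^sub>R a)"
    unfolding ab(2) using reflection_formula[OF ab(1)] by (rule ext)
  have "bij (reflection h)"
    by (rule involuntory_imp_bij) (rule reflection_involution[OF assms])
  moreover have "continuous_on UNIV (reflection h)"
    unfolding f by (intro continuous_intros) (use ab in auto)
  moreover have "reflection h ((1 - t) *\<^sub>R x + t *\<^sub>R y) = (1 - t) *\<^sub>R reflection h x + t *\<^sub>R reflection h y"
    for t x y
  proof -
    have 1: "a \<bullet> ((1 - t) *\<^sub>R x + t *\<^sub>R y) - b = (1 - t) * (a \<bullet> x - b) + t * (a \<bullet> y - b)"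
      by (simp add: inner_add_right algebra_simps)
    show ?thesis unfolding f 1 by (simp add: algebra_simps add_divide_distrib diff_divide_distrib)
  qed
  ultimately show ?thesis by (simp add: affine_bij_def)
qed

lemma reflection_moves:
  assumes "hyperplane h"
  shows "\<exists>x. reflection h x \<noteq> x"
proof -
  obtain a b where ab: "a \<noteq> 0" "h = {x. a \<bullet> x = b}" using hyperplaneE[OF assms] .
  have "a \<bullet> (((b + 1) / (a \<bullet> a)) *\<^sub>R a) = b + 1" using ab by simp
  then have "reflection h (((b + 1) / (a \<bullet> a)) *\<^sub>R a) \<noteq> ((b + 1) / (a \<bullet> a)) *\<^sub>R a"
    unfolding ab(2) reflection_formula[OF ab(1)] using ab(1) by simp
  then show ?thesis by blast
qed

lemma hyperplane_subset_eq:
  assumes "hyperplane h" "hyperplane k" "h \<subseteq> k"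
  shows "h = k"
proof -
  obtain a b where ab: "a \<noteq> 0" "h = {x. a \<bullet> x = b}" using hyperplaneE[OF assms(1)] .
  obtain c d where cd: "c \<noteq> 0" "k = {x. c \<bullet> x = d}" using hyperplaneE[OF assms(2)] .
  have "h \<noteq> {}" using ab by (auto intro!: exI[of _ "(b / (a \<bullet> a)) *\<^sub>R a"])
  then show ?thesis using assms(3) ab cd
    by (intro affine_dim_equal) (simp_all add: affine_hyperplane aff_dim_hyperplane)
qed

text \<open>Phrased by segments and not by signs, separation is visibly carried along by affine maps.
  It means lying on different sides only for points that are not on the hyperplane.\<close>

definition separates :: "'v::euclidean_space set \<Rightarrow> 'v \<Rightarrow> 'v \<Rightarrow> bool" where
  "separates h x y \<longleftrightarrow> h \<inter> closed_segment x y \<noteq> {}"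

lemma separates_iff:
  fixes a x y :: "'v::euclidean_space"
  assumes "a \<bullet> x \<noteq> b" "a \<bullet> y \<noteq> b"
  shows "separates {z. a \<bullet> z = b} x y \<longleftrightarrow> (a \<bullet> x - b) * (a \<bullet> y - b) < 0"
proof -
  let ?p = "a \<bullet> x - b" and ?q = "a \<bullet> y - b"
  have f: "a \<bullet> ((1 - u) *\<^sub>R x + u *\<^sub>R y) = b \<longleftrightarrow> (1 - u) * ?p + u * ?q = 0" for u
    by (simp add: inner_add_right algebra_simps)
  have "separates {z. a \<bullet> z = b} x y \<longleftrightarrow>
      (\<exists>u. 0 \<le> u \<and> u \<le> 1 \<and> a \<bullet> ((1 - u) *\<^sub>R x + u *\<^sub>R y) = b)"
    unfolding separates_def closed_segment_def by blast
  also have "\<dots> \<longleftrightarrow> (\<exists>u. 0 \<le> u \<and> u \<le> 1 \<and> (1 - u) * ?p + u * ?q = 0)"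
    unfolding f ..
  also have "\<dots> \<longleftrightarrow> ?p * ?q < 0"
  proof
    assume "\<exists>u. 0 \<le> u \<and> u \<le> 1 \<and> (1 - u) * ?p + u * ?q = 0"
    then obtain u where u: "0 \<le> u" "u \<le> 1" "(1 - u) * ?p + u * ?q = 0" by blast
    show "?p * ?q < 0"
    proof (rule ccontr)
      assume "\<not> ?p * ?q < 0"
      then have "0 < ?p * ?q" using assms by (simp add: less_le)
      then consider "0 < ?p" "0 < ?q" | "?p < 0" "?q < 0" by (auto simp: zero_less_mult_iff)
      then show False
      proof cases
        case 1
        then have "0 < (1 - u) * ?p + u * ?q"
          using u(1,2) by (cases "u = 0") (auto intro: add_nonneg_pos)
        then show False using u(3) by simp
      next
        case 2
        then have "(1 - u) * ?p + u * ?q < 0"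
          using u(1,2) by (cases "u = 0") (auto intro!: add_nonpos_neg mult_nonneg_nonpos mult_pos_neg)
        then show False using u(3) by simp
      qed
    qed
  next
    assume neg: "?p * ?q < 0"
    define u where "u = ?p / (?p - ?q)"
    have "?p - ?q \<noteq> 0" using neg by (auto simp: mult_less_0_iff)
    then have "(1 - u) * ?p + u * ?q = 0" by (simp add: u_def divide_simps) (simp add: algebra_simps)
    moreover have "0 \<le> u" "u \<le> 1"
      using neg by (auto simp: u_def mult_less_0_iff divide_le_eq zero_le_divide_iff)
    ultimately show "\<exists>u. 0 \<le> u \<and> u \<le> 1 \<and> (1 - u) * ?p + u * ?q = 0" by blast
  qed
  finally show ?thesis .
qed

lemma separates_trans:
  assumes "hyperplane h" "x \<notin> h" "y \<notin> h" "z \<notin> h"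
  shows "separates h x z \<longleftrightarrow> separates h x y \<noteq> separates h y z"
proof -
  obtain a b where ab: "a \<noteq> 0" "h = {x. a \<bullet> x = b}" using hyperplaneE[OF assms(1)] .
  then have n: "a \<bullet> x - b \<noteq> 0" "a \<bullet> y - b \<noteq> 0" "a \<bullet> z - b \<noteq> 0" using assms by simp_all
  have "(p * r < 0) \<longleftrightarrow> (p * q < 0) \<noteq> (q * r < 0)" if "p \<noteq> 0" "q \<noteq> 0" "r \<noteq> 0" for p q r :: real
    using that by (cases "p < 0"; cases "q < 0"; cases "r < 0") (simp_all add: mult_less_0_iff not_less)
  from this[OF n] n show ?thesis unfolding ab(2) by (simp add: separates_iff)
qed

lemma separates_reflection:
  assumes "hyperplane h"
  shows "separates h x (reflection h x)"
proof -
  obtain a b where ab: "a \<noteq> 0" "h = {x. a \<bullet> x = b}" using hyperplaneE[OF assms] .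
  have "h \<noteq> {}" using ab by (auto intro!: exI[of _ "(b / (a \<bullet> a)) *\<^sub>R a"])
  moreover have "closed h" using ab by (simp add: closed_hyperplane)
  ultimately have "closest_point h x \<in> h" by (rule closest_point_in_set[rotated])
  moreover have "closest_point h x = midpoint x (reflection h x)"
    by (simp add: reflection_def midpoint_def)
  moreover have "midpoint x (reflection h x) \<in> closed_segment x (reflection h x)" by simp
  ultimately show ?thesis unfolding separates_def by auto
qed

lemma finite_meeting_compact:
  fixes H :: "'v::euclidean_space set set"
  assumes "locally_finite_in euclidean H" "compact K"
  shows "finite {h \<in> H. h \<inter> K \<noteq> {}}"
proof -
  have "\<forall>x. \<exists>V. open V \<and> x \<in> V \<and> finite {h \<in> H. h \<inter> V \<noteq> {}}"
    using assms(1) by (simp add: locally_finite_in_def)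
  then obtain V where V: "\<And>x. open (V x)" "\<And>x. x \<in> V x" "\<And>x. finite {h \<in> H. h \<inter> V x \<noteq> {}}"
    by metis
  have "K \<subseteq> (\<Union>x\<in>UNIV. V x)" using V(2) by blast
  then obtain D where D: "finite D" "K \<subseteq> (\<Union>x\<in>D. V x)"
    by (rule compactE_image[OF assms(2) V(1)])
  have "{h \<in> H. h \<inter> K \<noteq> {}} \<subseteq> (\<Union>x\<in>D. {h \<in> H. h \<inter> V x \<noteq> {}})"
    using D(2) by blast
  moreover have "finite (\<Union>x\<in>D. {h \<in> H. h \<inter> V x \<noteq> {}})"
    using D(1) V(3) by (rule finite_UN_I)
  ultimately show ?thesis by (rule finite_subset)
qed

section \<open>Length as a number of walls\<close>

locale euclidean_reflection_system = coxeter_system I M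
  for I :: "'i set" and M :: "'i \<Rightarrow> 'i \<Rightarrow> enat" +
  fixes H :: "'v::euclidean_space set set" and P :: "'v set" and \<rho> :: "'i list set \<Rightarrow> 'v \<Rightarrow> 'v"
  assumes arrangement: "euclidean_arrangement H"
    and polytope_P: "polytope P"
    and facet_wall: "\<And>F. F facet_of P \<Longrightarrow> affine hull F \<in> H"
    and domain: "fundamental_domain (reflection_group H) P"
    and iso: "\<rho> \<in> iso W (reflection_group H)"
    and facets: "bij_betw (\<lambda>i. \<rho> (gen i)) I (facet_reflections P)"
begin

lemma hyperplane_H: "h \<in> H \<Longrightarrow> hyperplane h"
  and locally_finite_H: "locally_finite_in euclidean H"
  and H_invariant: "f \<in> carrier (reflection_group H) \<Longrightarrow> h \<in> H \<Longrightarrow> f ` h \<in> H"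
  using arrangement by (auto simp: euclidean_arrangement_def)

lemma convex_P: "convex P" and closed_P: "closed P"
  using polytope_P by (simp_all add: polytope_imp_convex polytope_imp_closed)

lemma interior_P: "interior P \<noteq> {}"
  and cover_P: "(\<Union>f\<in>carrier (reflection_group H). f ` P) = UNIV"
  and interior_disjoint: "f \<in> carrier (reflection_group H) \<Longrightarrow> f \<noteq> \<one>\<^bsub>reflection_group H\<^esub> \<Longrightarrow>
    interior P \<inter> interior (f ` P) = {}"
  using domain by (simp_all add: fundamental_domain_def)

lemma carrier_BijGroup: "carrier (BijGroup (UNIV :: 'v set)) = {f. bij f}"
  by (auto simp: BijGroup_def Bij_def)

lemma carrier_reflection_group: "f \<in> carrier (reflection_group H) \<Longrightarrow> bij f"
  using group.carrier_subgroup_generated_subset[OF group_BijGroup, of UNIV "reflection ` H"]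
  by (auto simp: reflection_group_def carrier_BijGroup)

lemma reflection_in_group: "h \<in> H \<Longrightarrow> reflection h \<in> carrier (reflection_group H)"
  using affine_bij_reflection[OF hyperplane_H, of h]
  by (auto simp: reflection_group_def carrier_subgroup_generated carrier_BijGroup affine_bij_def
      intro!: generate.incl)

lemma one_reflection_group: "\<one>\<^bsub>reflection_group H\<^esub> = id"
  by (simp add: reflection_group_def BijGroup_def fun_eq_iff)

lemma rho_in: "w \<in> carrier W \<Longrightarrow> \<rho> w \<in> carrier (reflection_group H)"
  and rho_inj: "inj_on \<rho> (carrier W)"
  and rho_surj: "\<rho> ` carrier W = carrier (reflection_group H)"
  using iso by (auto simp: iso_iff hom_def)

lemma rho_one: "\<rho> \<one>\<^bsub>W\<^esub> = id"
  using hom_one[of \<rho> W "reflection_group H"] iso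
    group.group_subgroup_generated[OF group_BijGroup, of UNIV "reflection ` H"] W.is_group
  unfolding one_reflection_group[symmetric] by (simp add: iso_iff reflection_group_def)

lemma rho_mult:
  assumes "x \<in> carrier W" "y \<in> carrier W"
  shows "\<rho> (x \<otimes>\<^bsub>W\<^esub> y) = \<rho> x \<circ> \<rho> y"
proof -
  have "\<rho> (x \<otimes>\<^bsub>W\<^esub> y) = \<rho> x \<otimes>\<^bsub>reflection_group H\<^esub> \<rho> y"
    using iso assms by (simp add: iso_iff hom_def)
  moreover have "bij (\<rho> x)" "bij (\<rho> y)" using assms rho_in carrier_reflection_group by simp_all
  ultimately show ?thesis
    by (simp add: reflection_group_def BijGroup_def Bij_def compose_def fun_eq_iff)
qed

lemma gen_facet:
  assumes "i \<in> I"
  obtains F where "F facet_of P" "\<rho> (gen i) = reflection (affine hull F)"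
proof -
  have "\<rho> (gen i) \<in> facet_reflections P" using facets assms by (auto simp: bij_betw_def)
  then show thesis using that by (auto simp: facet_reflections_def)
qed

lemma facet_gen:
  assumes "F facet_of P"
  obtains i where "i \<in> I" "\<rho> (gen i) = reflection (affine hull F)"
proof -
  have "reflection (affine hull F) \<in> facet_reflections P"
    using assms by (auto simp: facet_reflections_def)
  then have "reflection (affine hull F) \<in> (\<lambda>i. \<rho> (gen i)) ` I"
    using facets by (simp add: bij_betw_def)
  then show thesis using that by (auto simp: image_iff)
qed

lemma affine_rho: "w \<in> carrier W \<Longrightarrow> affine_bij (\<rho> w)"
proof (induction w rule: carrier_W_induct)
  case one
  then show ?case by (simp add: rho_one affine_bij_def bij_id[unfolded id_def])
next
  case (mult w i)
  obtain F where "F facet_of P" "\<rho> (gen i) = reflection (affine hull F)"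
    using gen_facet[OF mult(2)] .
  then have "affine_bij (\<rho> (gen i))"
    using affine_bij_reflection[OF hyperplane_H[OF facet_wall]] by simp
  from affine_bij_comp[OF mult(3) this] show ?case
    by (simp only: rho_mult[OF mult(1) gen_in_W[OF mult(2)]])
qed

lemma rho_wall: "w \<in> carrier W \<Longrightarrow> h \<in> H \<Longrightarrow> \<rho> w ` h \<in> H"
  using H_invariant rho_in by blast

lemma rho_cancel:
  assumes "w \<in> carrier W"
  shows "\<rho> w (\<rho> (inv\<^bsub>W\<^esub> w) x) = x" "\<rho> (inv\<^bsub>W\<^esub> w) (\<rho> w x) = x"
  using rho_mult[of w "inv\<^bsub>W\<^esub> w"] rho_mult[of "inv\<^bsub>W\<^esub> w" w] assms rho_one
  by (simp_all add: fun_eq_iff)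

text \<open>A reflection in a wall that meets the open chamber would fix a point of it and so map the
  chamber to an overlapping one, while the translates of a fundamental domain have disjoint
  interiors.\<close>

lemma interior_avoids_walls:
  assumes "x \<in> interior P" "h \<in> H"
  shows "x \<notin> h"
proof
  assume "x \<in> h"
  have r: "reflection h \<in> carrier (reflection_group H)" using reflection_in_group assms by simp
  have "reflection h \<noteq> \<one>\<^bsub>reflection_group H\<^esub>"
    using reflection_moves[OF hyperplane_H[OF assms(2)]] by (auto simp: one_reflection_group)
  then have e: "interior P \<inter> interior (reflection h ` P) = {}" by (rule interior_disjoint[OF r])
  have "reflection h -` interior P \<subseteq> reflection h ` P"
  proof
    fix y assume "y \<in> reflection h -` interior P"
    then have "reflection h y \<in> P" using interior_subset by blast
    then have "reflection h (reflection h y) \<in> reflection h ` P" by (rule imageI)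
    then show "y \<in> reflection h ` P"
      by (simp add: reflection_involution[OF hyperplane_H[OF assms(2)]])
  qed
  moreover have "open (reflection h -` interior P)"
    using affine_bij_reflection[OF hyperplane_H[OF assms(2)]]
    by (intro open_vimage) (simp_all add: affine_bij_def)
  moreover have "x \<in> reflection h -` interior P"
    using assms(1) \<open>x \<in> h\<close> by (simp add: reflection_fixes)
  ultimately have "x \<in> interior (reflection h ` P)" by (rule interiorI[rotated 2])
  then show False using e assms(1) by blast
qed

lemma chamber_avoids_walls:
  assumes "x \<in> interior P" "h \<in> H" "w \<in> carrier W"
  shows "\<rho> w x \<notin> h"
proof
  assume "\<rho> w x \<in> h"
  then have "\<rho> (inv\<^bsub>W\<^esub> w) (\<rho> w x) \<in> \<rho> (inv\<^bsub>W\<^esub> w) ` h" by (rule imageI)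
  then have "x \<in> \<rho> (inv\<^bsub>W\<^esub> w) ` h" using assms(3) by (simp add: rho_cancel)
  then show False
    using interior_avoids_walls[OF assms(1) rho_wall[OF _ assms(2), of "inv\<^bsub>W\<^esub> w"]] assms(3) by simp
qed

text \<open>A point in the open chamber; its images represent the chambers of the arrangement.\<close>

definition base :: 'v where "base = (SOME x. x \<in> interior P)"

abbreviation pt :: "'i list set \<Rightarrow> 'v" where "pt w \<equiv> \<rho> w base"

lemma base_interior: "base \<in> interior P"
  unfolding base_def using interior_P by (simp add: some_in_eq)

lemma pt_one: "pt \<one>\<^bsub>W\<^esub> = base"
  by (simp add: rho_one)

lemma pt_mult: "x \<in> carrier W \<Longrightarrow> y \<in> carrier W \<Longrightarrow> pt (x \<otimes>\<^bsub>W\<^esub> y) = \<rho> x (pt y)"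
  by (simp add: rho_mult)

lemma pt_avoids: "w \<in> carrier W \<Longrightarrow> h \<in> H \<Longrightarrow> pt w \<notin> h"
  using chamber_avoids_walls[OF base_interior] by simp

text \<open>Otherwise a segment from the base point of a chamber to one of its points would cross the wall
  before its end. But there it still runs in the interior of the chamber, where no wall is.\<close>

lemma chamber_side:
  assumes "w \<in> carrier W" "x \<in> P" "h \<in> H" "h = {y. a \<bullet> y = b}"
  shows "0 \<le> (a \<bullet> \<rho> w x - b) * (a \<bullet> pt w - b)"
proof (rule ccontr)
  assume "\<not> ?thesis"
  then have neg: "(a \<bullet> \<rho> w x - b) * (a \<bullet> pt w - b) < 0" by simp
  then have off: "a \<bullet> \<rho> w x \<noteq> b" "a \<bullet> pt w \<noteq> b" by auto
  have "separates h (\<rho> w x) (pt w)" unfolding assms(4) using separates_iff[OF off] neg by simp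
  then obtain m where m: "m \<in> h" "m \<in> \<rho> w ` closed_segment x base"
    unfolding separates_def affine_bij_segment[OF affine_rho[OF assms(1)]] by blast
  then obtain n where n: "n \<in> closed_segment x base" "m = \<rho> w n" by blast
  have "n \<noteq> x" using off m n assms(4) by auto
  moreover have "n \<noteq> base" using off m n assms(4) by auto
  ultimately have "n \<in> open_segment base x" using n(1) by (simp add: open_segment_def closed_segment_commute)
  moreover have "open_segment base x \<subseteq> interior P"
    by (rule in_interior_closure_convex_segment[OF convex_P base_interior]) (simp add: assms(2) closure_def)
  ultimately have "n \<in> interior P" by blast
  then show False using chamber_avoids_walls[OF _ assms(3,1), of n] m(1) n(2) by simp
qed

definition sep :: "'v \<Rightarrow> 'v \<Rightarrow> 'v set set" where
  "sep x y = {h \<in> H. separates h x y}"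

lemma finite_sep: "finite (sep x y)"
  using finite_meeting_compact[OF locally_finite_H, of "closed_segment x y"]
  by (simp add: sep_def separates_def)

lemma sep_image:
  assumes "w \<in> carrier W"
  shows "sep (\<rho> w x) (\<rho> w y) = (`) (\<rho> w) ` sep x y"
proof -
  have sub: "(`) (\<rho> z) ` sep x y \<subseteq> sep (\<rho> z x) (\<rho> z y)" if z: "z \<in> carrier W" for z x y
  proof
    fix k assume "k \<in> (`) (\<rho> z) ` sep x y"
    then obtain h where h: "h \<in> H" "separates h x y" "k = \<rho> z ` h" by (auto simp: sep_def)
    then obtain m where "m \<in> h" "m \<in> closed_segment x y" by (auto simp: separates_def)
    then have "\<rho> z m \<in> k" "\<rho> z m \<in> closed_segment (\<rho> z x) (\<rho> z y)"
      unfolding h(3) affine_bij_segment[OF affine_rho[OF z], symmetric] by (auto intro: imageI)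
    then show "k \<in> sep (\<rho> z x) (\<rho> z y)"
      using rho_wall[OF z h(1)] h(3) by (auto simp: sep_def separates_def)
  qed
  show ?thesis
  proof
    show "sep (\<rho> w x) (\<rho> w y) \<subseteq> (`) (\<rho> w) ` sep x y"
    proof
      fix h assume "h \<in> sep (\<rho> w x) (\<rho> w y)"
      then have "\<rho> (inv\<^bsub>W\<^esub> w) ` h \<in> sep x y"
        using sub[of "inv\<^bsub>W\<^esub> w" "\<rho> w x" "\<rho> w y"] assms by (simp add: rho_cancel image_subset_iff)
      moreover have "\<rho> w ` \<rho> (inv\<^bsub>W\<^esub> w) ` h = h" using assms by (simp add: image_image rho_cancel)
      ultimately show "h \<in> (`) (\<rho> w) ` sep x y" by (metis imageI)
    qed
  qed (rule sub[OF assms])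
qed

lemma card_sep_image: "w \<in> carrier W \<Longrightarrow> card (sep (\<rho> w x) (\<rho> w y)) = card (sep x y)"
  using affine_rho[of w] unfolding sep_image
  by (intro card_image inj_onI) (auto simp: affine_bij_def bij_def inj_image_eq_iff)

lemma separates_pt_trans:
  assumes "h \<in> H" "x \<in> carrier W" "y \<in> carrier W" "z \<in> carrier W"
  shows "separates h (pt x) (pt z) \<longleftrightarrow> separates h (pt x) (pt y) \<noteq> separates h (pt y) (pt z)"
  using assms by (intro separates_trans hyperplane_H pt_avoids)

text \<open>Neighbouring chambers share a facet. A wall between them has it weakly on both of its sides,
  so it contains the facet.\<close>

lemma sep_gen:
  assumes "i \<in> I" "F facet_of P" "\<rho> (gen i) = reflection (affine hull F)"
  shows "sep base (pt (gen i)) = {affine hull F}"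
proof -
  have F: "F \<noteq> {}" "F \<subseteq> P" using assms(2) facet_of_imp_subset by (auto simp: facet_of_def)
  have "h = affine hull F" if h: "h \<in> H" "separates h base (pt (gen i))" for h
  proof -
    obtain a b where ab: "a \<noteq> 0" "h = {x. a \<bullet> x = b}"
      using hyperplaneE[OF hyperplane_H[OF h(1)]] .
    have off: "a \<bullet> base \<noteq> b" "a \<bullet> pt (gen i) \<noteq> b"
      using pt_avoids[OF _ h(1), of "gen i"] pt_avoids[OF W.one_closed h(1)] assms(1) ab
      by (simp_all add: pt_one)
    have neg: "(a \<bullet> base - b) * (a \<bullet> pt (gen i) - b) < 0"
      using separates_iff[OF off] h(2) ab by simp
    have "y \<in> h" if y: "y \<in> F" for y
    proof -
      have "y \<in> P" using y F by blast
      moreover have "\<rho> (gen i) y = y" using y by (simp add: assms(3) reflection_fixes hull_inc)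
      ultimately have "0 \<le> (a \<bullet> y - b) * (a \<bullet> base - b)" "0 \<le> (a \<bullet> y - b) * (a \<bullet> pt (gen i) - b)"
        using chamber_side[OF W.one_closed _ h(1) ab(2), of y]
          chamber_side[OF gen_in_W[OF assms(1)] _ h(1) ab(2), of y] by (simp_all add: rho_one)
      then have "a \<bullet> y - b = 0" using neg by (auto simp: mult_less_0_iff zero_le_mult_iff)
      then show ?thesis using ab by simp
    qed
    then have "affine hull F \<subseteq> h" using ab by (intro hull_minimal) (auto simp: affine_hyperplane)
    then show ?thesis
      using hyperplane_subset_eq[OF hyperplane_H[OF facet_wall[OF assms(2)]] hyperplane_H[OF h(1)]]
      by simp
  qed
  moreover have "separates (affine hull F) base (pt (gen i))"
    using separates_reflection[OF hyperplane_H[OF facet_wall[OF assms(2)]]] assms(3) by simp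
  ultimately show ?thesis using facet_wall[OF assms(2)] unfolding sep_def by blast
qed

lemma card_sep_gen: "w \<in> carrier W \<Longrightarrow> i \<in> I \<Longrightarrow> card (sep (pt w) (pt (w \<otimes>\<^bsub>W\<^esub> gen i))) = 1"
proof -
  assume w: "w \<in> carrier W" and i: "i \<in> I"
  obtain F where F: "F facet_of P" "\<rho> (gen i) = reflection (affine hull F)" using gen_facet[OF i] .
  show ?thesis using card_sep_image[OF w, of base "pt (gen i)"] sep_gen[OF i F] w i
    by (simp add: pt_mult)
qed

lemma card_sep_le_length: "u \<in> lists I \<Longrightarrow> card (sep base (pt (cls u))) \<le> length u"
proof (induction u rule: rev_induct)
  case Nil
  have "sep base base = {}"
    using pt_avoids[OF W.one_closed] by (auto simp: sep_def separates_def pt_one)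
  then show ?case using pt_one by (simp add: one_W)
next
  case (snoc i u)
  then have u: "u \<in> lists I" "cls u \<in> carrier W" and i: "i \<in> I" by auto
  have "sep base (pt (cls u \<otimes>\<^bsub>W\<^esub> gen i)) \<subseteq>
      sep base (pt (cls u)) \<union> sep (pt (cls u)) (pt (cls u \<otimes>\<^bsub>W\<^esub> gen i))"
    using separates_pt_trans[OF _ W.one_closed u(2), of _ "cls u \<otimes>\<^bsub>W\<^esub> gen i"] u i
    by (auto simp: sep_def pt_one)
  then have "card (sep base (pt (cls u \<otimes>\<^bsub>W\<^esub> gen i))) \<le>
      card (sep base (pt (cls u))) + card (sep (pt (cls u)) (pt (cls u \<otimes>\<^bsub>W\<^esub> gen i)))"
    by (meson card_Un_le card_mono finite_UnI finite_sep le_trans)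
  then show ?case using snoc.IH[OF u(1)] card_sep_gen[OF u(2) i] cls_append[OF u(1), of "[i]"] i
    by simp
qed

text \<open>If a chamber \<open>z\<close> differs from the base chamber, then the segment from the base point to
  \<open>z\<close> leaves the polytope through a facet; the wall of that facet separates the two chambers, and
  reflecting in it brings \<open>z\<close> nearer.\<close>

lemma separating_facet:
  assumes "z \<in> carrier W" "z \<noteq> \<one>\<^bsub>W\<^esub>"
  obtains F where "F facet_of P" "affine hull F \<in> sep base (pt z)"
proof -
  have out: "pt z \<notin> P"
  proof
    assume "pt z \<in> P"
    have zi: "inv\<^bsub>W\<^esub> z \<in> carrier W" using assms by simp
    define U where "U = \<rho> (inv\<^bsub>W\<^esub> z) -` interior P"
    have U: "open U" unfolding U_def
      using affine_rho[OF zi] by (intro open_vimage) (simp_all add: affine_bij_def)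
    have "pt z \<in> U" using assms base_interior by (simp add: U_def rho_cancel)
    moreover have "pt z \<in> closure (interior P)"
      using \<open>pt z \<in> P\<close> convex_closure_interior[OF convex_P interior_P] closed_P by simp
    ultimately have "U \<inter> interior P \<noteq> {}" using open_Int_closure_eq_empty[OF U] by blast
    moreover have "U \<subseteq> interior (\<rho> z ` P)"
    proof (rule interior_maximal[OF _ U], rule subsetI)
      fix y assume "y \<in> U"
      then have "\<rho> (inv\<^bsub>W\<^esub> z) y \<in> P" using interior_subset by (auto simp: U_def)
      then have "\<rho> z (\<rho> (inv\<^bsub>W\<^esub> z) y) \<in> \<rho> z ` P" by (rule imageI)
      then show "y \<in> \<rho> z ` P" using assms by (simp add: rho_cancel)
    qed
    ultimately have "interior P \<inter> interior (\<rho> z ` P) \<noteq> {}" by blast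
    then have "\<rho> z = \<rho> \<one>\<^bsub>W\<^esub>"
      using interior_disjoint[OF rho_in[OF assms(1)]] by (auto simp: one_reflection_group rho_one)
    then show False using rho_inj assms by (simp add: inj_on_eq_iff)
  qed
  have "closed_segment base (pt z) \<inter> frontier P \<noteq> {}"
  proof (rule connected_Int_frontier)
    show "closed_segment base (pt z) \<inter> P \<noteq> {}" using base_interior interior_subset by fastforce
    show "closed_segment base (pt z) - P \<noteq> {}" using out by auto
  qed simp
  then obtain m where m: "m \<in> closed_segment base (pt z)" "m \<in> frontier P" by blast
  have "frontier P = \<Union> {F. F facet_of P}"
    using rel_frontier_of_polyhedron[OF polytope_imp_polyhedron[OF polytope_P]]
      rel_frontier_nonempty_interior[OF interior_P] by simp
  then obtain F where F: "F facet_of P" "m \<in> F" using m by auto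
  have "separates (affine hull F) base (pt z)"
    using m(1) F(2) hull_inc[of m F affine] by (auto simp: separates_def)
  then show thesis using that F facet_wall by (simp add: sep_def)
qed

text \<open>Each reflection in a separating facet removes at least one wall, so the chamber is reached
  after at most as many steps as there are walls.\<close>

lemma length_le_card_sep: "z \<in> carrier W \<Longrightarrow> len z \<le> card (sep base (pt z))"
proof (induction "card (sep base (pt z))" arbitrary: z rule: less_induct)
  case less
  show ?case
  proof (cases "z = \<one>\<^bsub>W\<^esub>")
    case False
    obtain F where F: "F facet_of P" "affine hull F \<in> sep base (pt z)"
      using separating_facet[OF less.prems False] .
    obtain i where i: "i \<in> I" "\<rho> (gen i) = reflection (affine hull F)" using facet_gen[OF F(1)] .
    let ?y = "gen i \<otimes>\<^bsub>W\<^esub> z"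
    have y: "?y \<in> carrier W" and g: "gen i \<in> carrier W" using i less.prems by simp_all
    have gi: "h = affine hull F \<longleftrightarrow> separates h base (pt (gen i))" if "h \<in> H" for h
      using sep_gen[OF i(1) F(1) i(2)] that by (auto simp: sep_def set_eq_iff)
    have tr: "separates h base (pt z) \<longleftrightarrow> separates h base (pt (gen i)) \<noteq> separates h (pt (gen i)) (pt z)"
      if "h \<in> H" for h
      using separates_pt_trans[OF that W.one_closed g less.prems] by (simp add: pt_one)
    have "sep (pt (gen i)) (pt z) \<subseteq> sep base (pt z) - {affine hull F}"
    proof
      fix h assume h: "h \<in> sep (pt (gen i)) (pt z)"
      then have "h \<in> H" "separates h (pt (gen i)) (pt z)" by (auto simp: sep_def)
      moreover have "h \<noteq> affine hull F"
        using tr[OF \<open>h \<in> H\<close>] gi[OF \<open>h \<in> H\<close>] F(2) calculation(2) by (auto simp: sep_def)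
      ultimately show "h \<in> sep base (pt z) - {affine hull F}"
        using tr[of h] gi[of h] by (simp add: sep_def)
    qed
    then have "card (sep (pt (gen i)) (pt z)) \<le> card (sep base (pt z) - {affine hull F})"
      by (intro card_mono) (simp_all add: finite_sep)
    also have "\<dots> < card (sep base (pt z))" using F(2) finite_sep by (intro psubset_card_mono) auto
    finally have lt: "card (sep (pt (gen i)) (pt z)) < card (sep base (pt z))" .
    have "card (sep base (pt ?y)) = card (sep (pt (gen i)) (pt z))"
      using card_sep_image[OF g, of base "pt ?y"] g less.prems i(1) pt_mult[OF g y]
      by (simp add: gen_cancel)
    then have "len ?y < card (sep base (pt z))" using less.hyps[OF _ y] lt by simp
    moreover have "len z \<le> 1 + len ?y"
      using len_mult_le[OF g y] i(1) less.prems by (simp add: gen_cancel)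
    ultimately show ?thesis by simp
  qed simp
qed

theorem length_eq_card_sep:
  assumes "x \<in> carrier W" "y \<in> carrier W"
  shows "len (inv\<^bsub>W\<^esub> x \<otimes>\<^bsub>W\<^esub> y) = card (sep (pt x) (pt y))"
proof -
  let ?z = "inv\<^bsub>W\<^esub> x \<otimes>\<^bsub>W\<^esub> y"
  have z: "?z \<in> carrier W" using assms by simp
  have "x \<otimes>\<^bsub>W\<^esub> ?z = y" using assms by (simp add: W.m_assoc[symmetric])
  then have c: "card (sep (pt x) (pt y)) = card (sep base (pt ?z))"
    using card_sep_image[OF assms(1), of base "pt ?z"] pt_mult[OF assms(1) z] by simp
  obtain u where u: "cls u = ?z" "length u = len ?z" "u \<in> lists I" using reduced_word_exists[OF z] .
  show ?thesis using card_sep_le_length[OF u(3)] length_le_card_sep[OF z] u c by simp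
qed

text \<open>The chambers \<open>p\<close> and \<open>q\<close> are found far away on a line through the base point. Only finitely
  many walls meet a given compact convex set \<open>K\<close> that contains the base point and the points of
  \<open>F\<close>, and a line transverse to all of these has its two ends on different sides of each of
  them. A wall that misses \<open>K\<close> leaves \<open>K\<close> on one side, and it cannot have both ends of the
  line on the other side, because the base point is their midpoint. So no wall separates a chamber
  of \<open>F\<close> from both \<open>p\<close> and \<open>q\<close>.\<close>

theorem finite_set_between:
  assumes "finite F" "F \<subseteq> carrier W"
  obtains p q where "p \<in> carrier W" "q \<in> carrier W"
    "\<And>x. x \<in> F \<Longrightarrow> len (inv\<^bsub>W\<^esub> p \<otimes>\<^bsub>W\<^esub> q) = len (inv\<^bsub>W\<^esub> p \<otimes>\<^bsub>W\<^esub> x) + len (inv\<^bsub>W\<^esub> x \<otimes>\<^bsub>W\<^esub> q)"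
proof -
  define K where "K = convex hull (insert base (pt ` F))"
  define HK where "HK = {h \<in> H. h \<inter> K \<noteq> {}}"
  have "compact K" unfolding K_def using assms(1) by (intro finite_imp_compact_convex_hull) simp
  then have finHK: "finite HK" unfolding HK_def by (rule finite_meeting_compact[OF locally_finite_H])
  have "\<forall>h\<in>H. \<exists>n c. n \<noteq> 0 \<and> h = {x. n \<bullet> x = c}"
    using hyperplane_H by (simp add: hyperplane_def)
  then obtain n c where nc: "\<And>h. h \<in> H \<Longrightarrow> n h \<noteq> 0" "\<And>h. h \<in> H \<Longrightarrow> h = {x. n h \<bullet> x = c h}"
    by metis
  define f where "f h x = n h \<bullet> x - c h" for h x
  have mem: "x \<in> h \<longleftrightarrow> f h x = 0" if "h \<in> H" for h x
    using nc(2)[OF that] by (auto simp: f_def)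
  have side: "0 \<le> f h (\<rho> w x) * f h (pt w)" if "w \<in> carrier W" "x \<in> P" "h \<in> H" for w x h
    unfolding f_def using that(1,2,3) nc(2)[OF that(3)] by (rule chamber_side)
  have off: "f h (pt w) \<noteq> 0" if "w \<in> carrier W" "h \<in> H" for w h
    using pt_avoids[OF that] mem[OF that(2)] by simp
  have separ: "separates h (pt x) (pt y) \<longleftrightarrow> f h (pt x) * f h (pt y) < 0"
    if "x \<in> carrier W" "y \<in> carrier W" "h \<in> H" for x y h
    using separates_iff[of "n h" "pt x" "c h" "pt y"] off[OF that(1,3)] off[OF that(2,3)]
      nc(2)[OF that(3)] by (simp add: f_def)
  have "(\<Union>h\<in>HK. {v. n h \<bullet> v = 0}) \<noteq> UNIV"
  proof -
    have "negligible (\<Union>h\<in>HK. {v. n h \<bullet> v = 0})"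
      using finHK nc(1) by (intro negligible_Union) (auto simp: HK_def intro!: negligible_hyperplane)
    then show ?thesis by force
  qed
  then obtain v where v: "\<And>h. h \<in> HK \<Longrightarrow> n h \<bullet> v \<noteq> 0" by blast
  \<comment> \<open>large enough for the two ends of the line to lie on different sides of each wall in \<open>HK\<close>\<close>
  define \<tau> where "\<tau> = 1 + (\<Sum>h\<in>HK. \<bar>f h base\<bar> / \<bar>n h \<bullet> v\<bar>)"
  have far: "\<bar>f h base\<bar> < \<bar>n h \<bullet> (\<tau> *\<^sub>R v)\<bar>" if h: "h \<in> HK" for h
  proof -
    have "\<bar>f h base\<bar> / \<bar>n h \<bullet> v\<bar> \<le> (\<Sum>h\<in>HK. \<bar>f h base\<bar> / \<bar>n h \<bullet> v\<bar>)"
      using h finHK by (intro member_le_sum) auto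
    then have "\<bar>f h base\<bar> / \<bar>n h \<bullet> v\<bar> < \<tau>" by (simp add: \<tau>_def)
    then have "\<bar>f h base\<bar> < \<tau> * \<bar>n h \<bullet> v\<bar>" using v[OF h] by (simp add: divide_less_eq)
    also have "\<dots> \<le> \<bar>\<tau>\<bar> * \<bar>n h \<bullet> v\<bar>" by (rule mult_right_mono) simp_all
    finally show ?thesis by (simp add: abs_mult)
  qed
  have cover: "\<exists>w\<in>carrier W. \<exists>x\<in>P. y = \<rho> w x" for y
  proof -
    have "y \<in> (\<Union>f\<in>\<rho> ` carrier W. f ` P)" unfolding rho_surj cover_P by (rule UNIV_I)
    then show ?thesis by auto
  qed
  obtain p y where p: "p \<in> carrier W" "y \<in> P" "base - \<tau> *\<^sub>R v = \<rho> p y" using cover by blast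
  obtain q z where q: "q \<in> carrier W" "z \<in> P" "base + \<tau> *\<^sub>R v = \<rho> q z" using cover by blast
  have fp: "f h (\<rho> p y) = f h base - n h \<bullet> (\<tau> *\<^sub>R v)"
    and fq: "f h (\<rho> q z) = f h base + n h \<bullet> (\<tau> *\<^sub>R v)" for h
    by (simp_all add: f_def inner_diff_right inner_add_right flip: p(3) q(3))
  have ends: "separates h (pt p) (pt q)" if h: "h \<in> HK" for h
  proof -
    have hH: "h \<in> H" using h by (simp add: HK_def)
    have "f h (\<rho> p y) * f h (\<rho> q z) < 0"
    proof -
      have "(e - d) * (e + d) < 0" if "\<bar>e\<bar> < \<bar>d\<bar>" for e d :: real
        using abs_le_square_iff[of d e] that by (simp add: algebra_simps power2_eq_square)
      then show ?thesis using far[OF h] by (simp add: fp fq)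
    qed
    then show ?thesis
      using side[OF p(1,2) hH] side[OF q(1,2) hH] off[OF p(1) hH] off[OF q(1) hH]
      by (simp add: separ[OF p(1) q(1) hH] mult_less_0_iff zero_le_mult_iff) linarith
  qed
  have not_both: "\<not> (separates h (pt p) (pt x) \<and> separates h (pt x) (pt q))"
    if x: "x \<in> F" and h: "h \<in> H" for x h
  proof
    assume both: "separates h (pt p) (pt x) \<and> separates h (pt x) (pt q)"
    have xW: "x \<in> carrier W" using x assms(2) by blast
    have "\<not> separates h (pt p) (pt q)"
      using separates_pt_trans[OF h p(1) xW q(1)] both by simp
    then have "h \<notin> HK" using ends by blast
    moreover have "closed_segment (pt \<one>\<^bsub>W\<^esub>) (pt x) \<subseteq> K"
      unfolding K_def pt_one using x by (intro closed_segment_subset) (auto intro: hull_inc)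
    ultimately have "\<not> separates h (pt \<one>\<^bsub>W\<^esub>) (pt x)"
      using h unfolding HK_def separates_def by blast
    then have "0 < f h base * f h (pt x)"
      using separ[OF W.one_closed xW h] off[OF W.one_closed h] off[OF xW h]
      by (simp add: pt_one not_less le_less)
    moreover have "f h (pt p) * f h (pt x) < 0" "f h (pt x) * f h (pt q) < 0"
      using both separ[OF p(1) xW h] separ[OF xW q(1) h] by simp_all
    \<comment> \<open>\<open>p\<close>, \<open>q\<close> and so both ends of the line are beyond \<open>h\<close>, as seen from their midpoint\<close>
    moreover have "0 \<le> f h (\<rho> p y) * f h (pt p)" "0 \<le> f h (\<rho> q z) * f h (pt q)"
      using side p q h by blast+
    moreover have "f h (\<rho> p y) + f h (\<rho> q z) = 2 * f h base" by (simp add: fp fq)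
    ultimately show False
      by (simp add: mult_less_0_iff zero_less_mult_iff zero_le_mult_iff) linarith
  qed
  have "len (inv\<^bsub>W\<^esub> p \<otimes>\<^bsub>W\<^esub> q) = len (inv\<^bsub>W\<^esub> p \<otimes>\<^bsub>W\<^esub> x) + len (inv\<^bsub>W\<^esub> x \<otimes>\<^bsub>W\<^esub> q)"
    if x: "x \<in> F" for x
  proof -
    have xW: "x \<in> carrier W" using x assms(2) by blast
    have "sep (pt p) (pt q) = sep (pt p) (pt x) \<union> sep (pt x) (pt q)"
      using separates_pt_trans[OF _ p(1) xW q(1)] not_both[OF x] unfolding sep_def by blast
    moreover have "sep (pt p) (pt x) \<inter> sep (pt x) (pt q) = {}"
      using not_both[OF x] unfolding sep_def by blast
    ultimately show ?thesis
      using length_eq_card_sep p(1) q(1) xW by (simp add: card_Un_disjoint finite_sep)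
  qed
  with p(1) q(1) show thesis by (rule that)
qed

end

text \<open>With no generators there is no arrangement to count walls in, but then \<open>W\<close> is trivial.\<close>

lemma euclidean_type_finite_set_between:
  assumes "euclidean_type TYPE('v::euclidean_space) I M"
    and "finite F" "F \<subseteq> carrier (coxeter_group I M)"
  obtains p q where "p \<in> carrier (coxeter_group I M)" "q \<in> carrier (coxeter_group I M)"
    "\<And>x. x \<in> F \<Longrightarrow>
       coxeter_length I M (inv\<^bsub>coxeter_group I M\<^esub> p \<otimes>\<^bsub>coxeter_group I M\<^esub> q) =
       coxeter_length I M (inv\<^bsub>coxeter_group I M\<^esub> p \<otimes>\<^bsub>coxeter_group I M\<^esub> x) +
       coxeter_length I M (inv\<^bsub>coxeter_group I M\<^esub> x \<otimes>\<^bsub>coxeter_group I M\<^esub> q)"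
proof -
  interpret coxeter_system I M
    by unfold_locales (use assms(1) in \<open>simp add: euclidean_type_def\<close>)
  show thesis
  proof (cases "I = {}")
    case True
    then have "carrier W = {\<one>\<^bsub>W\<^esub>}" unfolding carrier_W one_W by simp
    then have "x = \<one>\<^bsub>W\<^esub>" if "x \<in> F" for x using that assms(3) by blast
    then show ?thesis using that[of "\<one>\<^bsub>W\<^esub>" "\<one>\<^bsub>W\<^esub>"] by fastforce
  next
    case False
    then obtain H :: "'v set set" and P \<rho> where "euclidean_arrangement H" "polytope P"
      "\<forall>F. F facet_of P \<longrightarrow> affine hull F \<in> H" "fundamental_domain (reflection_group H) P"
      "\<rho> \<in> iso W (reflection_group H)" "bij_betw (\<lambda>i. \<rho> (gen i)) I (facet_reflections P)"
      using assms(1) unfolding euclidean_type_def by blast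
    then interpret euclidean_reflection_system I M H P \<rho> by unfold_locales auto
    show ?thesis by (rule finite_set_between[OF assms(2,3)]) (rule that)
  qed
qed

section \<open>Isometries from the Coxeter group and apartments\<close>

context building_of_type
begin

text \<open>A partial isometry from \<open>W\<close> to the chambers is given by its graph, so that extension is
  inclusion. Such a relation is automatically a function, because chambers at trivial distance are
  equal.\<close>

definition isometric :: "('i list set \<times> 'c) set \<Rightarrow> bool" where
  "isometric R \<longleftrightarrow> R \<subseteq> carrier W \<times> C \<and>
     (\<forall>x c y d. (x, c) \<in> R \<longrightarrow> (y, d) \<in> R \<longrightarrow> \<delta> c d = inv\<^bsub>W\<^esub> x \<otimes>\<^bsub>W\<^esub> y)"

lemma isometricD:
  assumes "isometric R" "(x, c) \<in> R"
  shows "x \<in> carrier W" "c \<in> C" "\<And>y d. (y, d) \<in> R \<Longrightarrow> \<delta> c d = inv\<^bsub>W\<^esub> x \<otimes>\<^bsub>W\<^esub> y"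
  using assms unfolding isometric_def by blast+

lemma delta_self: "c \<in> C \<Longrightarrow> \<delta> c c = \<one>\<^bsub>W\<^esub>"
  by (simp add: delta_one)

lemma left_translate_gen_cases:
  assumes "y \<in> carrier W" "i \<in> I"
  obtains "len (gen i \<otimes>\<^bsub>W\<^esub> y) = Suc (len y)" | "len y = Suc (len (gen i \<otimes>\<^bsub>W\<^esub> y))"
proof -
  have e: "inv\<^bsub>W\<^esub> y \<otimes>\<^bsub>W\<^esub> gen i = inv\<^bsub>W\<^esub> (gen i \<otimes>\<^bsub>W\<^esub> y)"
    using assms by (simp add: W.inv_mult_group inv_gen)
  have l: "len (inv\<^bsub>W\<^esub> y \<otimes>\<^bsub>W\<^esub> gen i) = len (gen i \<otimes>\<^bsub>W\<^esub> y)" "len (inv\<^bsub>W\<^esub> y) = len y"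
    unfolding e using assms by (simp_all add: len_inv)
  show thesis
    by (rule len_mult_gen_cases[of "inv\<^bsub>W\<^esub> y" i]) (use assms l that in auto)
qed

text \<open>The mirror images of the facts on steps, for the first argument of the distance.\<close>

lemma delta_step_up_left:
  assumes "b \<in> C" "a \<in> C" "adj i b c" "len (gen i \<otimes>\<^bsub>W\<^esub> \<delta> b a) = Suc (len (\<delta> b a))"
  shows "\<delta> c a = gen i \<otimes>\<^bsub>W\<^esub> \<delta> b a"
proof -
  have i: "i \<in> I" and c: "c \<in> C" using assms adj_I adj_C by auto
  have e: "\<delta> a b \<otimes>\<^bsub>W\<^esub> gen i = inv\<^bsub>W\<^esub> (gen i \<otimes>\<^bsub>W\<^esub> \<delta> b a)"
    using i assms delta_inv[of b a] by (simp add: W.inv_mult_group inv_gen)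
  have l: "len (\<delta> a b) = len (\<delta> b a)" using delta_inv[OF assms(1,2)] len_inv assms by simp
  have "len (\<delta> a b \<otimes>\<^bsub>W\<^esub> gen i) = Suc (len (\<delta> a b))"
    unfolding e l using assms i by (subst len_inv) simp_all
  then have "\<delta> a c = \<delta> a b \<otimes>\<^bsub>W\<^esub> gen i" by (rule delta_step_up[OF assms(2,1,3)])
  then show ?thesis using delta_inv[of a c] e assms i c by simp
qed

lemma gate_exists_left:
  assumes "b \<in> C" "a \<in> C" "i \<in> I" "len (\<delta> b a) = Suc (len (gen i \<otimes>\<^bsub>W\<^esub> \<delta> b a))"
  obtains p where "adj i b p" "\<delta> p a = gen i \<otimes>\<^bsub>W\<^esub> \<delta> b a"
proof -
  have e: "\<delta> a b \<otimes>\<^bsub>W\<^esub> gen i = inv\<^bsub>W\<^esub> (gen i \<otimes>\<^bsub>W\<^esub> \<delta> b a)"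
    using assms delta_inv[of b a] by (simp add: W.inv_mult_group inv_gen)
  have l: "len (\<delta> a b) = len (\<delta> b a)" using delta_inv[OF assms(1,2)] len_inv assms by simp
  have "len (\<delta> a b) = Suc (len (\<delta> a b \<otimes>\<^bsub>W\<^esub> gen i))"
    unfolding e l using assms by (subst len_inv) simp_all
  then obtain p where p: "adj i b p" "\<delta> a p = \<delta> a b \<otimes>\<^bsub>W\<^esub> gen i"
    by (rule gate_exists[OF assms(2,1,3)])
  have "p \<in> C" using p adj_C by blast
  then have "\<delta> p a = gen i \<otimes>\<^bsub>W\<^esub> \<delta> b a" using delta_inv[of a p] p e assms by simp
  with p(1) show thesis by (rule that)
qed

text \<open>Here \<open>e\<close> is a first step from \<open>b\<close> towards \<open>a\<^sub>1\<close>, and \<open>b\<close> has an \<open>i\<close>-neighbour that is a first step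
  towards \<open>a\<close>. If that were not \<open>e\<close>, then \<open>e\<close> would be at the same distance from \<open>a\<close> as \<open>b\<close>. A
  minimal gallery from \<open>e\<close> to \<open>a\<^sub>1\<close> would then express \<open>\<delta> b a\<^sub>1\<close> by as many letters as it has steps,
  which is fewer than the length of \<open>\<delta> b a\<^sub>1\<close>.\<close>

lemma common_gate:
  assumes C: "b \<in> C" "a \<in> C" "a\<^sub>1 \<in> C"
    and compatible: "\<delta> a a\<^sub>1 = \<delta> a b \<otimes>\<^bsub>W\<^esub> \<delta> b a\<^sub>1"
    and e: "adj i b e" "\<delta> e a\<^sub>1 = gen i \<otimes>\<^bsub>W\<^esub> \<delta> b a\<^sub>1"
    and down1: "len (\<delta> b a\<^sub>1) = Suc (len (gen i \<otimes>\<^bsub>W\<^esub> \<delta> b a\<^sub>1))"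
    and down: "len (\<delta> b a) = Suc (len (gen i \<otimes>\<^bsub>W\<^esub> \<delta> b a))"
  shows "\<delta> e a = gen i \<otimes>\<^bsub>W\<^esub> \<delta> b a"
proof -
  have i: "i \<in> I" and eC: "e \<in> C" using e adj_I adj_C by auto
  obtain p where p: "adj i b p" "\<delta> p a = gen i \<otimes>\<^bsub>W\<^esub> \<delta> b a"
    by (rule gate_exists_left[OF C(1,2) i down])
  have pC: "p \<in> C" using p adj_C by blast
  have "p = e"
  proof (rule ccontr)
    assume "p \<noteq> e"
    then have pe: "adj i p e" using adj_trans[OF adjacent_sym[OF p(1)] e(1)] by simp
    have "\<delta> e a = gen i \<otimes>\<^bsub>W\<^esub> \<delta> p a"
      using down i C by (intro delta_step_up_left[OF pC C(2) pe]) (simp add: p(2) gen_cancel)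
    then have ea: "\<delta> e a = \<delta> b a" using i C by (simp add: p(2) gen_cancel)
    obtain v where v: "length v = len (\<delta> e a\<^sub>1)" "joined B v e a\<^sub>1"
      by (rule delta_reduced_gallery[OF eC C(3)])
    obtain z where z: "z \<in> carrier W" "len z \<le> length v" "\<delta> a a\<^sub>1 = \<delta> a e \<otimes>\<^bsub>W\<^esub> z"
      using delta_along_gallery[OF C(2) eC v(2)] by blast
    have "\<delta> a e = \<delta> a b" using delta_inv[of e a] delta_inv[of b a] ea C eC by simp
    then have "\<delta> a b \<otimes>\<^bsub>W\<^esub> z = \<delta> a b \<otimes>\<^bsub>W\<^esub> \<delta> b a\<^sub>1" using z(3) compatible by simp
    then have "z = \<delta> b a\<^sub>1" using z(1) C by simp
    then show False using z(2) v(1) e(2) down1 by simp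
  qed
  then show ?thesis using p by simp
qed

text \<open>The new value has to be an \<open>i\<close>-neighbour \<open>e\<close> of \<open>c0\<close>. Every neighbour has the right distance to
  those \<open>c\<close> for which multiplication by \<open>i\<close> lengthens \<open>\<delta> c0 c\<close>. For the other \<open>c\<close> it has to be a
  first step towards \<open>c\<close>, and by the preceding lemma a first step towards one of them serves
  all.\<close>

lemma isometric_extend_step:
  assumes R: "isometric R" "(x0, c0) \<in> R" and i: "i \<in> I"
  shows "\<exists>e. isometric (insert (x0 \<otimes>\<^bsub>W\<^esub> gen i, e) R)"
proof -
  note x0 = isometricD[OF R]
  define shorter where
    "shorter c \<longleftrightarrow> len (\<delta> c0 c) = Suc (len (gen i \<otimes>\<^bsub>W\<^esub> \<delta> c0 c))" for c
  have "\<exists>e. adj i c0 e \<and> (\<forall>(x, c)\<in>R. \<delta> e c = gen i \<otimes>\<^bsub>W\<^esub> \<delta> c0 c)"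
  proof -
    have up: "\<delta> e c = gen i \<otimes>\<^bsub>W\<^esub> \<delta> c0 c" if e: "adj i c0 e" and c: "c \<in> C" and "\<not> shorter c" for e c
    proof (rule delta_step_up_left[OF x0(2) c e])
      show "len (gen i \<otimes>\<^bsub>W\<^esub> \<delta> c0 c) = Suc (len (\<delta> c0 c))"
        by (rule left_translate_gen_cases[of "\<delta> c0 c" i])
          (use \<open>\<not> shorter c\<close> x0(2) c i in \<open>simp_all add: shorter_def\<close>)
    qed
    show ?thesis
    proof (cases "\<exists>(x, c)\<in>R. shorter c")
      case False
      obtain e where e: "adj i c0 e" using adj_exists[OF x0(2) i] by blast
      have "\<delta> e c = gen i \<otimes>\<^bsub>W\<^esub> \<delta> c0 c" if "(x, c) \<in> R" for x c
        using up[OF e isometricD(2)[OF R(1) that]] False that by blast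
      then show ?thesis using e by blast
    next
      case True
      then obtain x1 c1 where 1: "(x1, c1) \<in> R" "shorter c1" by blast
      have c1: "c1 \<in> C" using isometricD(2)[OF R(1) 1(1)] .
      obtain e where e: "adj i c0 e" "\<delta> e c1 = gen i \<otimes>\<^bsub>W\<^esub> \<delta> c0 c1"
        by (rule gate_exists_left[OF x0(2) c1 i 1(2)[unfolded shorter_def]])
      have "\<delta> e c = gen i \<otimes>\<^bsub>W\<^esub> \<delta> c0 c" if xc: "(x, c) \<in> R" for x c
      proof (cases "shorter c")
        case True
        note x = isometricD[OF R(1) xc]
        have x1: "x1 \<in> carrier W" using isometricD(1)[OF R(1) 1(1)] .
        have "\<delta> c c1 = \<delta> c c0 \<otimes>\<^bsub>W\<^esub> \<delta> c0 c1"
          using x(3)[OF 1(1)] x(3)[OF R(2)] x0(3)[OF 1(1)] x(1) x0(1) x1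
          by (simp add: W.m_assoc) (simp add: W.m_assoc[symmetric])
        then show ?thesis
          using True 1(2) unfolding shorter_def
          by (intro common_gate[OF x0(2) x(2) c1 _ e]) simp_all
      qed (rule up[OF e(1) isometricD(2)[OF R(1) xc]])
      then show ?thesis using e by blast
    qed
  qed
  then obtain e where e: "adj i c0 e" "\<And>x c. (x, c) \<in> R \<Longrightarrow> \<delta> e c = gen i \<otimes>\<^bsub>W\<^esub> \<delta> c0 c" by blast
  have eC: "e \<in> C" using e(1) adj_C by blast
  let ?y = "x0 \<otimes>\<^bsub>W\<^esub> gen i"
  have y: "?y \<in> carrier W" using x0 i by simp
  have ec: "\<delta> e c = inv\<^bsub>W\<^esub> ?y \<otimes>\<^bsub>W\<^esub> x" if xc: "(x, c) \<in> R" for x c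
    using e(2)[OF xc] x0(3)[OF xc] isometricD(1)[OF R(1) xc] x0(1) i
    by (simp add: W.inv_mult_group inv_gen W.m_assoc)
  have ce: "\<delta> c e = inv\<^bsub>W\<^esub> x \<otimes>\<^bsub>W\<^esub> ?y" if xc: "(x, c) \<in> R" for x c
    using delta_inv[OF eC isometricD(2)[OF R(1) xc]] ec[OF xc] isometricD(1)[OF R(1) xc] y
    by (simp add: W.inv_mult_group)
  have "isometric (insert (?y, e) R)"
    unfolding isometric_def
  proof (intro conjI allI impI)
    show "insert (?y, e) R \<subseteq> carrier W \<times> C" using R(1) y eC by (simp add: isometric_def)
    fix x c z d
    assume xc: "(x, c) \<in> insert (?y, e) R" and zd: "(z, d) \<in> insert (?y, e) R"
    show "\<delta> c d = inv\<^bsub>W\<^esub> x \<otimes>\<^bsub>W\<^esub> z"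
    proof (cases "(x, c) \<in> R"; cases "(z, d) \<in> R")
      assume "(x, c) \<notin> R" "(z, d) \<notin> R"
      then have "x = ?y" "c = e" "z = ?y" "d = e" using xc zd by auto
      then show ?thesis using y eC by (simp add: delta_self)
    qed (use xc zd ec ce isometricD(3)[OF R(1)] in \<open>simp_all\<close>)
  qed
  then show ?thesis ..
qed

text \<open>A maximal extension exists by Zorn's lemma, and by the single steps its domain is closed under
  right multiplication by generators.\<close>

theorem isometric_extend:
  assumes R: "isometric R" "R \<noteq> {}"
  obtains S where "R \<subseteq> S" "isometric S" "fst ` S = carrier W"
proof -
  let ?\<A> = "{S. isometric S \<and> R \<subseteq> S}"
  have "\<exists>S\<in>?\<A>. \<forall>X\<in>?\<A>. S \<subseteq> X \<longrightarrow> X = S"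
  proof (rule subset_Zorn_nonempty)
    show "?\<A> \<noteq> {}" using R by blast
    fix \<C> assume \<C>: "\<C> \<noteq> {}" "subset.chain ?\<A> \<C>"
    have iso: "isometric S" "R \<subseteq> S" if "S \<in> \<C>" for S
      using \<C>(2) that by (auto simp: subset.chain_def)
    have "isometric (\<Union>\<C>)"
      unfolding isometric_def
    proof (intro conjI allI impI)
      show "\<Union>\<C> \<subseteq> carrier W \<times> C"
        by (rule Union_least) (use iso(1) in \<open>simp add: isometric_def\<close>)
      fix x c y d assume "(x, c) \<in> \<Union>\<C>" "(y, d) \<in> \<Union>\<C>"
      then obtain S where "S \<in> \<C>" "(x, c) \<in> S" "(y, d) \<in> S"
        using \<C>(2) unfolding subset_chain_def by blast
      then show "\<delta> c d = inv\<^bsub>W\<^esub> x \<otimes>\<^bsub>W\<^esub> y" using isometricD(3)[OF iso(1)] by simp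
    qed
    moreover have "R \<subseteq> \<Union>\<C>" using \<C>(1) iso(2) by blast
    ultimately show "\<Union>\<C> \<in> ?\<A>" by simp
  qed
  then obtain S where S: "isometric S" "R \<subseteq> S" "\<And>X. isometric X \<Longrightarrow> S \<subseteq> X \<Longrightarrow> X = S"
    by (auto dest: order_trans)
  obtain x0 c0 where x0: "(x0, c0) \<in> S" using S(2) R(2) by auto
  have x0W: "x0 \<in> carrier W" using isometricD(1)[OF S(1) x0] .
  have reach: "x0 \<otimes>\<^bsub>W\<^esub> w \<in> fst ` S" if "w \<in> carrier W" for w
    using that
  proof (induction w rule: carrier_W_induct)
    case one
    then show ?case using x0 x0W by force
  next
    case (mult w i)
    then obtain c where c: "(x0 \<otimes>\<^bsub>W\<^esub> w, c) \<in> S" by auto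
    obtain e where "isometric (insert (x0 \<otimes>\<^bsub>W\<^esub> w \<otimes>\<^bsub>W\<^esub> gen i, e) S)"
      using isometric_extend_step[OF S(1) c mult(2)] by blast
    from S(3)[OF this] have "(x0 \<otimes>\<^bsub>W\<^esub> w \<otimes>\<^bsub>W\<^esub> gen i, e) \<in> S" by auto
    moreover have "x0 \<otimes>\<^bsub>W\<^esub> w \<otimes>\<^bsub>W\<^esub> gen i = x0 \<otimes>\<^bsub>W\<^esub> (w \<otimes>\<^bsub>W\<^esub> gen i)"
      using mult x0W by (simp add: W.m_assoc)
    ultimately show ?case by force
  qed
  have "carrier W \<subseteq> fst ` S"
  proof
    fix y assume y: "y \<in> carrier W"
    have "x0 \<otimes>\<^bsub>W\<^esub> (inv\<^bsub>W\<^esub> x0 \<otimes>\<^bsub>W\<^esub> y) = y" using y x0W by (simp add: W.m_assoc[symmetric])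
    then show "y \<in> fst ` S" using reach[of "inv\<^bsub>W\<^esub> x0 \<otimes>\<^bsub>W\<^esub> y"] y x0W by simp
  qed
  moreover have "fst ` S \<subseteq> carrier W" using isometricD(1)[OF S(1)] by force
  ultimately have "fst ` S = carrier W" by blast
  with S(2,1) show thesis by (rule that)
qed

end

section \<open>Apartments\<close>

lemma full_subgraph_simps [simp]:
  "chambers (full_subgraph B A) = A"
  "edges (full_subgraph B A) = {e \<in> edges B. e \<subseteq> A}"
  "colour (full_subgraph B A) = colour B"
  "wdist (full_subgraph B A) = wdist B"
  by (simp_all add: full_subgraph_def)

lemma adjacent_full_subgraph:
  "adjacent (full_subgraph B A) i a b \<longleftrightarrow> adjacent B i a b \<and> a \<in> A \<and> b \<in> A"
  by (auto simp: adjacent_def)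

lemma joined_wdist_update: "joined (B\<lparr>wdist := d\<rparr>) u a b = joined B u a b"
  by (induction u arbitrary: a) (simp_all add: adjacent_def)

lemma joined_full_subgraph:
  "joined (full_subgraph B A) u a b \<Longrightarrow> a \<in> A \<Longrightarrow> joined B u a b \<and> b \<in> A"
proof (induction u arbitrary: a)
  case (Cons i u)
  then obtain c where c: "adjacent B i a c" "c \<in> A" "joined (full_subgraph B A) u c b"
    by (auto simp: adjacent_full_subgraph)
  then show ?case using Cons.IH[OF c(3,2)] by auto
qed simp

context building_of_type
begin

lemma simplicial_full_subgraph: "simplicial_graph A (edges (full_subgraph B A))"
  using graph by (simp add: simplicial_graph_def)

lemma isometric_functional:
  assumes "isometric S" "(x, c) \<in> S" "(x, d) \<in> S"
  shows "c = d"
proof -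
  have "\<delta> c d = \<one>\<^bsub>W\<^esub>" using isometricD[OF assms(1,2)] assms(3) by simp
  then show ?thesis using delta_one isometricD(2)[OF assms(1)] assms by simp
qed

lemma isometric_gen:
  assumes "isometric S" "(x, a) \<in> S" "(x \<otimes>\<^bsub>W\<^esub> gen i, b) \<in> S" "i \<in> I"
  shows "adj i a b"
proof -
  note a = isometricD[OF assms(1,2)] and b = isometricD(2)[OF assms(1,3)]
  have "\<delta> a b = gen i" using a(3)[OF assms(3)] a(1) assms(4) by (simp add: W.m_assoc[symmetric])
  then show ?thesis using delta_gen[OF a(2) b assms(4)] by simp
qed

text \<open>A gallery in the image corresponds to a word, because adjacency of chambers can be read off
  their distance; so the image inherits galleries and thinness from \<open>W\<close>.\<close>

lemma isometric_image_apartment: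
  assumes S: "isometric S" "fst ` S = carrier W"
  shows "apartment I M B (snd ` S)"
proof -
  define A where "A = snd ` S"
  define X where "X = full_subgraph B A"
  have memA: "a \<in> A \<longleftrightarrow> (\<exists>x. (x, a) \<in> S)" for a by (force simp: A_def)
  have sub: "A \<subseteq> C" using isometricD(2)[OF S(1)] memA by blast
  have total: "\<exists>a. (x, a) \<in> S" if "x \<in> carrier W" for x
    using that S(2)[symmetric] by auto
  have step: "\<exists>b. (x \<otimes>\<^bsub>W\<^esub> gen i, b) \<in> S \<and> adjacent X i a b" if "(x, a) \<in> S" "i \<in> I" for x a i
  proof -
    have "x \<otimes>\<^bsub>W\<^esub> gen i \<in> carrier W" using isometricD(1)[OF S(1) that(1)] that(2) by simp
    then obtain b where b: "(x \<otimes>\<^bsub>W\<^esub> gen i, b) \<in> S" using total by blast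
    have "adj i a b" by (rule isometric_gen[OF S(1) that(1) b that(2)])
    then show ?thesis using b that memA by (auto simp: X_def adjacent_full_subgraph)
  qed
  have gal: "joined X v a b" if "v \<in> lists I" "(x, a) \<in> S" "(x \<otimes>\<^bsub>W\<^esub> cls v, b) \<in> S" for v x a b
    using that
  proof (induction v arbitrary: x a rule: list.induct)
    case Nil
    have "(x, a) \<in> S" "(x \<otimes>\<^bsub>W\<^esub> \<one>\<^bsub>W\<^esub>, b) \<in> S" using Nil by (simp_all add: one_W)
    then show ?case
      using isometricD(1)[OF S(1), of x a] isometric_functional[OF S(1), of x a b] by simp
  next
    case (Cons i v)
    then have v: "v \<in> lists I" and i: "i \<in> I" by auto
    obtain c where c: "(x \<otimes>\<^bsub>W\<^esub> gen i, c) \<in> S" "adjacent X i a c" using step[OF Cons.prems(2) i] by blast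
    have "x \<otimes>\<^bsub>W\<^esub> cls (i # v) = x \<otimes>\<^bsub>W\<^esub> gen i \<otimes>\<^bsub>W\<^esub> cls v"
      using cls_Cons[OF i v] isometricD(1)[OF S(1) Cons.prems(2)] i v by (simp add: W.m_assoc)
    then have "joined X v c b" using Cons.IH[OF v c(1)] Cons.prems(3) by simp
    then show ?case using c(2) by auto
  qed
  have "building I M (X\<lparr>wdist := \<delta>\<rparr>)"
    unfolding building_def
  proof (intro conjI ballI allI impI)
    show "coxeter_matrix I M" by (rule matrix)
    show "simplicial_graph (chambers (X\<lparr>wdist := \<delta>\<rparr>)) (edges (X\<lparr>wdist := \<delta>\<rparr>))"
      using simplicial_full_subgraph[of A] by (simp add: X_def)
    show "colour (X\<lparr>wdist := \<delta>\<rparr>) \<in> edges (X\<lparr>wdist := \<delta>\<rparr>) \<rightarrow> I"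
      using colour_I by (auto simp: X_def)
  next
    fix a b assume ab: "a \<in> chambers (X\<lparr>wdist := \<delta>\<rparr>)" "b \<in> chambers (X\<lparr>wdist := \<delta>\<rparr>)"
    then have A: "a \<in> A" "b \<in> A" by (simp_all add: X_def)
    then have C: "a \<in> C" "b \<in> C" using sub by blast+
    then show "wdist (X\<lparr>wdist := \<delta>\<rparr>) a b \<in> carrier W" by simp
    fix u assume u: "reduced I M u"
    have "simplicial_graph (chambers (X\<lparr>wdist := \<delta>\<rparr>)) (edges (X\<lparr>wdist := \<delta>\<rparr>))"
      using simplicial_full_subgraph[of A] by (simp add: X_def)
    note g = gallery_iff_joined[OF this ab(1), of u b]
    have "\<delta> a b = cls u \<longleftrightarrow> joined X u a b"
    proof
      assume d: "\<delta> a b = cls u"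
      obtain x y where xy: "(x, a) \<in> S" "(y, b) \<in> S" using A memA by blast
      have "cls u = inv\<^bsub>W\<^esub> x \<otimes>\<^bsub>W\<^esub> y" using isometricD(3)[OF S(1) xy] d by simp
      then have "x \<otimes>\<^bsub>W\<^esub> cls u = y"
        using isometricD(1)[OF S(1) xy(1)] isometricD(1)[OF S(1) xy(2)] by (simp add: W.m_assoc[symmetric])
      then show "joined X u a b" using gal[OF reduced_lists[OF u] xy(1)] xy(2) by simp
    next
      assume "joined X u a b"
      then show "\<delta> a b = cls u"
        using joined_full_subgraph[of B A u a b] A(1) joined_delta[OF u C(1)] by (simp add: X_def)
    qed
    then show "(wdist (X\<lparr>wdist := \<delta>\<rparr>) a b = cls u) \<longleftrightarrow>
        (\<exists>cs. gallery (X\<lparr>wdist := \<delta>\<rparr>) u cs \<and> hd cs = a \<and> last cs = b)"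
      unfolding g joined_wdist_update by simp
  next
    fix a i assume "a \<in> chambers (X\<lparr>wdist := \<delta>\<rparr>)" and i: "i \<in> I"
    then obtain x where x: "(x, a) \<in> S" using memA by (auto simp: X_def)
    obtain b where "(x \<otimes>\<^bsub>W\<^esub> gen i, b) \<in> S" "adjacent X i a b" using step[OF x i] by blast
    then show "\<exists>b\<in>chambers (X\<lparr>wdist := \<delta>\<rparr>). adjacent (X\<lparr>wdist := \<delta>\<rparr>) i a b"
      using memA[of b] by (intro bexI[of _ b]) (auto simp: X_def adjacent_def)
  next
    fix a i b c
    assume "adjacent (X\<lparr>wdist := \<delta>\<rparr>) i a b \<and> adjacent (X\<lparr>wdist := \<delta>\<rparr>) i a c \<and> b \<noteq> c"
    then have "adjacent X i a b" "adjacent X i a c" "b \<noteq> c" by (simp_all add: adjacent_def)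
    then have "adj i a b" "adj i a c" "b \<noteq> c" "b \<in> A" "c \<in> A"
      by (simp_all add: X_def adjacent_full_subgraph)
    then have "adj i b c" "b \<in> A" "c \<in> A" using adj_trans[OF adjacent_sym] by blast+
    then have "adjacent X i b c" by (simp add: X_def adjacent_full_subgraph)
    then show "adjacent (X\<lparr>wdist := \<delta>\<rparr>) i b c" by (simp add: adjacent_def)
  qed
  moreover have "thin I X"
    unfolding thin_def
  proof (intro ballI)
    fix a i assume "a \<in> chambers X" and i: "i \<in> I"
    then obtain x where x: "(x, a) \<in> S" using memA by (auto simp: X_def)
    obtain b where b: "(x \<otimes>\<^bsub>W\<^esub> gen i, b) \<in> S" "adjacent X i a b" using step[OF x i] by blast
    show "\<exists>!b. b \<in> chambers X \<and> adjacent X i a b"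
    proof (rule ex1I[of _ b])
      show "b \<in> chambers X \<and> adjacent X i a b" using b memA by (auto simp: X_def)
      fix c assume c: "c \<in> chambers X \<and> adjacent X i a c"
      then obtain y where y: "(y, c) \<in> S" using memA by (auto simp: X_def)
      have "adj i a c" using c by (simp add: X_def adjacent_full_subgraph)
      then have "gen i = inv\<^bsub>W\<^esub> x \<otimes>\<^bsub>W\<^esub> y"
        using delta_gen[OF isometricD(2)[OF S(1) x] isometricD(2)[OF S(1) y] i]
          isometricD(3)[OF S(1) x y] by simp
      then have "x \<otimes>\<^bsub>W\<^esub> gen i = y"
        using isometricD(1)[OF S(1) x] isometricD(1)[OF S(1) y] by (simp add: W.m_assoc[symmetric])
      then show "c = b" using isometric_functional[OF S(1), of y c b] y b(1) by simp
    qed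
  qed
  ultimately show ?thesis
    unfolding apartment_def subbuilding_def A_def[symmetric] X_def using sub by blast
qed

theorem apartment_through:
  assumes "a \<in> C" "b \<in> C"
  obtains A where "apartment I M B A" "a \<in> A" "b \<in> A"
proof -
  have "isometric {(\<one>\<^bsub>W\<^esub>, a), (\<delta> a b, b)}"
    using assms delta_inv[OF assms] by (auto simp: isometric_def delta_self)
  then obtain S where S: "{(\<one>\<^bsub>W\<^esub>, a), (\<delta> a b, b)} \<subseteq> S" "isometric S" "fst ` S = carrier W"
    by (rule isometric_extend) auto
  have "a \<in> snd ` S" "b \<in> snd ` S" using S(1) by force+
  then show thesis using that isometric_image_apartment[OF S(2,3)] by blast
qed

end

text \<open>Conversely, the Weyl distance from any chamber of an apartment identifies the apartment with
  \<open>W\<close>: by thinness a gallery in it is determined by its start and its type.\<close>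

locale building_apartment = building_of_type I M B
  for I :: "'i set" and M :: "'i \<Rightarrow> 'i \<Rightarrow> enat" and B :: "('c, 'i, 'i list set) coloured_graph" +
  fixes A :: "'c set"
  assumes apartment_A: "apartment I M B A"
begin

abbreviation X where "X \<equiv> full_subgraph B A"

lemma A_sub: "A \<subseteq> C" and thin_X: "thin I X"
  using apartment_A by (simp_all add: apartment_def subbuilding_def)

lemma A_C: "a \<in> A \<Longrightarrow> a \<in> C"
  using A_sub by blast

lemma step_unique: "adjacent X i a b \<Longrightarrow> adjacent X i a c \<Longrightarrow> b = c"
  using thin_X adj_I[of i a b] by (auto simp: thin_def adjacent_full_subgraph)

lemma step_exists: "a \<in> A \<Longrightarrow> i \<in> I \<Longrightarrow> \<exists>b. adjacent X i a b"
  using thin_X unfolding thin_def full_subgraph_simps by blast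

lemma gallery_unique: "joined X u a b \<Longrightarrow> joined X u a c \<Longrightarrow> b = c"
proof (induction u arbitrary: a)
  case (Cons i u)
  then obtain d e where "adjacent X i a d" "joined X u d b" "adjacent X i a e" "joined X u e c"
    by auto
  then show ?case using Cons.IH step_unique[of i a d e] by simp
qed simp

lemma gallery_exists: "a \<in> A \<Longrightarrow> u \<in> lists I \<Longrightarrow> \<exists>b. joined X u a b"
proof (induction u arbitrary: a)
  case Nil
  show ?case by (rule exI[of _ a]) simp
next
  case (Cons i u)
  then have i: "i \<in> I" and u: "u \<in> lists I" by auto
  obtain d where d: "adjacent X i a d" using step_exists[OF Cons.prems(1) i] by blast
  then have "d \<in> A" by (simp add: adjacent_full_subgraph)
  then obtain b where "joined X u d b" using Cons.IH[OF _ u] by blast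
  then show ?case using d by auto
qed

text \<open>As a building, the apartment has its own Weyl distance \<open>d\<close>. A reduced gallery in \<open>A\<close> is also one
  in the whole building, so \<open>d\<close> agrees with \<open>\<delta>\<close>.\<close>

lemma delta_gallery_in_A:
  assumes "reduced I M u" "a \<in> A" "b \<in> A"
  shows "\<delta> a b = cls u \<longleftrightarrow> joined X u a b"
proof -
  obtain d where d: "building I M (X\<lparr>wdist := d\<rparr>)"
    using apartment_A unfolding apartment_def subbuilding_def by blast
  interpret X: building_of_type I M "X\<lparr>wdist := d\<rparr>"
    by unfold_locales (rule d)
  have iff: "d a b = cls v \<longleftrightarrow> joined X v a b" if "reduced I M v" for v
    using X.delta_iff_joined[OF that, of a b] assms(2,3) by (simp add: joined_wdist_update)
  have imp: "\<delta> a b = cls v" if "reduced I M v" "joined X v a b" for v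
    using joined_full_subgraph[OF that(2) assms(2)] joined_delta[OF that(1)] A_sub assms(2) by blast
  have "d a b \<in> carrier W" using X.delta_W[of a b] assms(2,3) by simp
  then obtain v where v: "reduced I M v" "cls v = d a b" by (rule reduced_word_exists)
  have "joined X v a b" by (rule iffD1[OF iff[OF v(1)] v(2)[symmetric]])
  then have "\<delta> a b = d a b" using imp[OF v(1)] v(2) by simp
  then show ?thesis using iff[OF assms(1)] by simp
qed

lemma delta_inj:
  assumes "a \<in> A" "b \<in> A" "c \<in> A" "\<delta> a b = \<delta> a c"
  shows "b = c"
proof -
  have "a \<in> C" "b \<in> C" using assms A_sub by blast+
  then obtain u where u: "reduced I M u" "cls u = \<delta> a b" by (rule delta_reduced_gallery)
  then have "joined X u a b" "joined X u a c"
    using delta_gallery_in_A[OF u(1) assms(1,2)] delta_gallery_in_A[OF u(1) assms(1,3)] u(2) assms(4)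
    by simp_all
  then show ?thesis by (rule gallery_unique)
qed

lemma delta_surj:
  assumes "a \<in> A" "w \<in> carrier W"
  shows "\<exists>b\<in>A. \<delta> a b = w"
proof -
  obtain u where u: "reduced I M u" "cls u = w" by (rule reduced_word_exists[OF assms(2)])
  obtain b where b: "joined X u a b" using gallery_exists[OF assms(1) reduced_lists[OF u(1)]] by blast
  have "b \<in> A" using joined_full_subgraph[OF b assms(1)] by simp
  then show ?thesis using delta_gallery_in_A[OF u(1) assms(1)] b u by auto
qed

lemma delta_step_in_A:
  assumes "a \<in> A" "adjacent X i b c"
  shows "\<delta> a c = \<delta> a b \<otimes>\<^bsub>W\<^esub> gen i"
proof -
  have bc: "adj i b c" "b \<in> A" "c \<in> A" using assms(2) by (simp_all add: adjacent_full_subgraph)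
  have "\<delta> a c \<noteq> \<delta> a b" using delta_inj[OF assms(1) bc(2,3)] adj_C(3)[OF bc(1)] by auto
  moreover have "\<delta> a c = \<delta> a b \<or> \<delta> a c = \<delta> a b \<otimes>\<^bsub>W\<^esub> gen i"
    using bc A_sub assms(1) by (intro delta_step) auto
  ultimately show ?thesis by simp
qed

lemma delta_gallery_mult:
  assumes "a \<in> A" "b \<in> A" "joined X u b c"
  shows "\<delta> a c = \<delta> a b \<otimes>\<^bsub>W\<^esub> cls u"
  using assms(2,3)
proof (induction u arbitrary: b)
  case Nil
  then have "\<delta> a b \<in> carrier W" using Nil assms(1,2) A_C by simp
  then show ?case using Nil by (simp add: one_W[symmetric])
next
  case (Cons i u)
  then obtain d where d: "adjacent X i b d" "joined X u d c" by auto
  have D: "adj i b d" "d \<in> A" using d(1) by (simp_all add: adjacent_full_subgraph)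
  have u: "u \<in> lists I" using joined_full_subgraph[OF d(2) D(2)] joined_I by blast
  have i: "i \<in> I" using D adj_I by blast
  have "\<delta> a b \<in> carrier W" using assms(1) Cons.prems(1) A_C by simp
  then show ?case
    using Cons.IH[OF D(2) d(2)] delta_step_in_A[OF assms(1) d(1)] cls_Cons[OF i u] i u
    by (simp add: W.m_assoc)
qed

text \<open>Along a gallery in \<open>A\<close> the distance from \<open>a\<close> never stutters, since distinct chambers of \<open>A\<close> are at
  distinct distances from \<open>a\<close>.\<close>

theorem delta_in_apartment:
  assumes "a \<in> A" "b \<in> A" "c \<in> A"
  shows "\<delta> b c = inv\<^bsub>W\<^esub> \<delta> a b \<otimes>\<^bsub>W\<^esub> \<delta> a c"
proof -
  have C: "a \<in> C" "b \<in> C" "c \<in> C" using assms A_sub by blast+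
  obtain u where u: "reduced I M u" "cls u = \<delta> b c" by (rule delta_reduced_gallery[OF C(2,3)])
  then have "joined X u b c" using delta_gallery_in_A[OF u(1) assms(2,3)] by simp
  then have "\<delta> a c = \<delta> a b \<otimes>\<^bsub>W\<^esub> \<delta> b c"
    using delta_gallery_mult[OF assms(1,2)] u(2) by simp
  then show ?thesis using C by (simp add: W.m_assoc[symmetric])
qed

end

section \<open>Automorphisms\<close>

context building_of_type
begin

lemma automorphism_adj:
  assumes "building_automorphism B f" "adj i a b"
  shows "adj i (f a) (f b)"
proof -
  have "a \<in> C" "b \<in> C" using adj_C[OF assms(2)] by auto
  moreover have "{a, b} \<in> edges B" "colour B {a, b} = i" using assms(2) by (simp_all add: adjacent_def)
  moreover have "colour B (f ` {a, b}) = colour B {a, b}"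
    using assms(1) calculation(3) unfolding building_automorphism_def by blast
  ultimately show ?thesis using assms(1) by (simp add: adjacent_def building_automorphism_def)
qed

lemma automorphism_delta:
  assumes "building_automorphism B f" "a \<in> C" "b \<in> C"
  shows "\<delta> (f a) (f b) = \<delta> a b"
proof -
  have j: "joined B u (f c) (f b)" if "joined B u c b" for u c
    using that by (induction u arbitrary: c) (auto intro: automorphism_adj[OF assms(1)])
  have "f a \<in> C" using assms(1,2) by (auto simp: building_automorphism_def bij_betw_def)
  moreover obtain u where u: "reduced I M u" "cls u = \<delta> a b" "joined B u a b"
    by (rule delta_reduced_gallery[OF assms(2,3)])
  ultimately show ?thesis using joined_delta[OF u(1)] j by simp
qed

text \<open>The composite of \<open>W \<rightarrow> A\<close> with an automorphism is again an isometry.\<close>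

lemma automorphism_apartment:
  assumes f: "building_automorphism B f" and A: "apartment I M B A"
  shows "apartment I M B (f ` A)"
proof (cases "A = {}")
  case False
  interpret building_apartment I M B A by unfold_locales (rule A)
  obtain a where a: "a \<in> A" using False by blast
  define S where "S = (\<lambda>x. (\<delta> a x, f x)) ` A"
  have "isometric S"
    unfolding isometric_def
  proof (intro conjI allI impI)
    have "f ` C = C" using f by (simp add: building_automorphism_def bij_betw_def)
    then show "S \<subseteq> carrier W \<times> C" using a A_C by (auto simp: S_def)
    fix x c y d assume "(x, c) \<in> S" "(y, d) \<in> S"
    then obtain p q where pq: "p \<in> A" "x = \<delta> a p" "c = f p" "q \<in> A" "y = \<delta> a q" "d = f q"
      by (auto simp: S_def)
    have "\<delta> c d = \<delta> p q" using automorphism_delta[OF f, of p q] pq A_C by simp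
    then show "\<delta> c d = inv\<^bsub>W\<^esub> x \<otimes>\<^bsub>W\<^esub> y" using delta_in_apartment[OF a pq(1,4)] pq by simp
  qed
  moreover have "fst ` S = carrier W"
  proof
    show "fst ` S \<subseteq> carrier W" unfolding S_def image_image using a A_C by (intro image_subsetI) simp
    show "carrier W \<subseteq> fst ` S" using delta_surj[OF a] unfolding S_def image_image by fastforce
  qed
  moreover have "snd ` S = f ` A" by (simp add: S_def image_image)
  ultimately show ?thesis using isometric_image_apartment[of S] by simp
qed (use A in simp)

end

section \<open>Proper actions on discrete spaces\<close>

text \<open>Properness makes the set of all \<open>g\<close> that send one given point to another compact, and
  continuity on a discrete space makes it closed. So a map on an arbitrary set of points is
  induced by a group element as soon as all its finite restrictions are.\<close>

lemma proper_discrete_action_interpolation: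
  assumes proper: "proper_action G T (discrete_topology C) \<phi>" and T: "topspace T = carrier G"
    and A: "A \<subseteq> C" and f: "f ` A \<subseteq> C"
    and fin: "\<And>F. finite F \<Longrightarrow> F \<subseteq> A \<Longrightarrow> \<exists>g\<in>carrier G. \<forall>x\<in>F. \<phi> g x = f x"
  shows "\<exists>g\<in>carrier G. \<forall>x\<in>A. \<phi> g x = f x"
proof (cases "A = {}")
  case True
  then show ?thesis using fin[of "{}"] by simp
next
  case False
  then obtain a where a: "a \<in> A" by blast
  define S where "S x = {g \<in> carrier G. \<phi> g x = f x}" for x
  let ?D = "discrete_topology C"
  have cont: "continuous_map (prod_topology T ?D) ?D (\<lambda>(g, x). \<phi> g x)"
    and pm: "proper_map (prod_topology T ?D) (prod_topology ?D ?D) (\<lambda>(g, x). (\<phi> g x, x))"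
    using proper by (simp_all add: proper_action_def continuous_action_def)
  have fa: "f a \<in> C" "a \<in> C" using a A f by auto
  have "(f a, a) \<in> topspace (prod_topology ?D ?D)" using fa by simp
  then have "compactin (prod_topology T ?D)
      {z \<in> topspace (prod_topology T ?D). (case z of (g, x) \<Rightarrow> (\<phi> g x, x)) = (f a, a)}"
    using pm by (simp only: proper_map_def)
  from image_compactin[OF this continuous_map_fst]
  have "compactin T (fst ` {z \<in> topspace (prod_topology T ?D). (case z of (g, x) \<Rightarrow> (\<phi> g x, x)) = (f a, a)})" .
  also have "fst ` {z \<in> topspace (prod_topology T ?D). (case z of (g, x) \<Rightarrow> (\<phi> g x, x)) = (f a, a)} = S a"
    using fa by (force simp: S_def T)
  finally have comp: "compactin T (S a)" .
  have closed: "closedin T (S x)" if x: "x \<in> A" for x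
  proof -
    have "continuous_map T (prod_topology T ?D) (\<lambda>g. (g, x))"
      using x A by (intro continuous_map_pairedI) auto
    from continuous_map_compose[OF this cont] have "continuous_map T ?D (\<lambda>g. \<phi> g x)"
      by (simp add: o_def)
    moreover have "closedin ?D {f x}" using x f by auto
    ultimately have "closedin T {g \<in> topspace T. \<phi> g x \<in> {f x}}"
      by (rule closedin_continuous_map_preimage)
    then show ?thesis by (simp add: S_def T)
  qed
  have "S a \<inter> \<Inter>\<F> \<noteq> {}" if \<F>: "finite \<F>" "\<F> \<subseteq> S ` A" for \<F>
  proof -
    obtain F where F: "F \<subseteq> A" "finite F" "\<F> = S ` F" using finite_subset_image[OF \<F>] by blast
    obtain g where "g \<in> carrier G" "\<forall>x\<in>insert a F. \<phi> g x = f x"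
      using fin[of "insert a F"] F a by auto
    then have "g \<in> S a \<inter> \<Inter>\<F>" using F by (auto simp: S_def)
    then show ?thesis by blast
  qed
  moreover have "\<forall>X\<in>S ` A. closedin T X" using closed by blast
  ultimately have "S a \<inter> \<Inter>(S ` A) \<noteq> {}"
    using comp unfolding compactin_fip by blast
  then obtain g where "g \<in> S a" "\<forall>x\<in>A. g \<in> S x" by blast
  then show ?thesis by (auto simp: S_def)
qed

section \<open>Weyl transitivity and strong transitivity\<close>

context building_of_type
begin

lemma strongly_imp_weyl_transitive:
  assumes aut: "\<And>g. g \<in> carrier G \<Longrightarrow> building_automorphism B (\<phi> g)"
    and strong: "strongly_transitive G (maximal_atlas I M B) \<phi>"
  shows "weyl_transitive G B \<phi>"
  unfolding weyl_transitive_def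
proof (intro ballI impI)
  fix a b a' b' assume C: "a \<in> C" "b \<in> C" "a' \<in> C" "b' \<in> C" and eq: "\<delta> a b = \<delta> a' b'"
  obtain A where A: "apartment I M B A" "a \<in> A" "b \<in> A" by (rule apartment_through[OF C(1,2)])
  obtain A' where A': "apartment I M B A'" "a' \<in> A'" "b' \<in> A'" by (rule apartment_through[OF C(3,4)])
  obtain g where g: "g \<in> carrier G" "\<phi> g a = a'" "\<phi> g ` A = A'"
    using strong A(1,2) A'(1,2) unfolding strongly_transitive_def maximal_atlas_def by blast
  interpret A': building_apartment I M B A' by unfold_locales (rule A'(1))
  have "\<phi> g b \<in> A'" using g(3) A(3) by blast
  moreover have "\<delta> a' (\<phi> g b) = \<delta> a' b'"
    using automorphism_delta[OF aut[OF g(1)] C(1,2)] g(2) eq by simp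
  ultimately have "\<phi> g b = b'" using A'.delta_inj[OF A'(2) _ A'(3)] by simp
  then show "\<exists>g\<in>carrier G. \<phi> g a = a' \<and> \<phi> g b = b'" using g by blast
qed

text \<open>The map \<open>f\<close> matches the chambers of \<open>A\<close> and \<open>A'\<close> that have the same distance from \<open>a\<close> and \<open>a'\<close>. On a
  finite set it is induced by any group element that does the right thing to two chambers between
  which this set lies.\<close>

lemma weyl_imp_strongly_transitive:
  assumes euclidean: "euclidean_type TYPE('v::euclidean_space) I M"
    and T: "topspace T = carrier G"
    and proper: "proper_action G T (discrete_topology C) \<phi>"
    and aut: "\<And>g. g \<in> carrier G \<Longrightarrow> building_automorphism B (\<phi> g)"
    and weyl: "weyl_transitive G B \<phi>"
  shows "strongly_transitive G (maximal_atlas I M B) \<phi>"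
  unfolding strongly_transitive_def
proof (intro conjI ballI)
  fix g A assume "g \<in> carrier G" "A \<in> maximal_atlas I M B"
  then show "\<phi> g ` A \<in> maximal_atlas I M B"
    using automorphism_apartment[OF aut] by (simp add: maximal_atlas_def)
next
  fix A A' a a' assume "A \<in> maximal_atlas I M B" "A' \<in> maximal_atlas I M B" and a: "a \<in> A" "a' \<in> A'"
  then have AA': "apartment I M B A" "apartment I M B A'" by (simp_all add: maximal_atlas_def)
  interpret A: building_apartment I M B A by unfold_locales (rule AA')
  interpret A': building_apartment I M B A' by unfold_locales (rule AA')
  have "\<exists>y\<in>A'. \<delta> a' y = \<delta> a x" if "x \<in> A" for x
    using A'.delta_surj[OF a(2)] delta_W[OF A.A_C[OF a(1)] A.A_C[OF that]] by blast
  then obtain f where f: "\<And>x. x \<in> A \<Longrightarrow> f x \<in> A'" "\<And>x. x \<in> A \<Longrightarrow> \<delta> a' (f x) = \<delta> a x" by metis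
  have iso: "\<delta> (f x) (f y) = \<delta> x y" if "x \<in> A" "y \<in> A" for x y
    using A.delta_in_apartment[OF a(1) that] A'.delta_in_apartment[OF a(2) f(1)[OF that(1)] f(1)[OF that(2)]]
      f(2) that by simp
  have fa: "f a = a'"
    using A'.delta_inj[OF a(2) f(1)[OF a(1)] a(2)] f(2)[OF a(1)] a A.A_C A'.A_C by (simp add: delta_self)
  have fA: "f ` A = A'"
  proof (rule antisym)
    show "A' \<subseteq> f ` A"
    proof
      fix y assume y: "y \<in> A'"
      obtain x where x: "x \<in> A" "\<delta> a x = \<delta> a' y"
        using A.delta_surj[OF a(1) delta_W[OF A'.A_C[OF a(2)] A'.A_C[OF y]]] by blast
      then have "f x = y" using A'.delta_inj[OF a(2) f(1)[OF x(1)] y] f(2)[OF x(1)] by simp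
      then show "y \<in> f ` A" using x by blast
    qed
  qed (use f(1) in blast)
  have finite: "\<exists>g\<in>carrier G. \<forall>x\<in>F. \<phi> g x = f x" if F: "finite F" "F \<subseteq> A" for F
  proof -
    have sub: "\<delta> a ` F \<subseteq> carrier W" using F(2) a(1) A.A_C by (intro image_subsetI) auto
    obtain p' q' where pq': "p' \<in> carrier W" "q' \<in> carrier W"
      "\<And>x. x \<in> \<delta> a ` F \<Longrightarrow> len (inv\<^bsub>W\<^esub> p' \<otimes>\<^bsub>W\<^esub> q') = len (inv\<^bsub>W\<^esub> p' \<otimes>\<^bsub>W\<^esub> x) + len (inv\<^bsub>W\<^esub> x \<otimes>\<^bsub>W\<^esub> q')"
      by (rule euclidean_type_finite_set_between[OF euclidean finite_imageI[OF F(1)] sub]) (rule that)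
    obtain p where p: "p \<in> A" "\<delta> a p = p'" using A.delta_surj[OF a(1) pq'(1)] by blast
    obtain q where q: "q \<in> A" "\<delta> a q = q'" using A.delta_surj[OF a(1) pq'(2)] by blast
    have between: "len (\<delta> p q) = len (\<delta> p x) + len (\<delta> x q)" if x: "x \<in> F" for x
    proof -
      have xA: "x \<in> A" using x F(2) by blast
      show ?thesis
        using pq'(3)[OF imageI[OF x]] A.delta_in_apartment[OF a(1) p(1) q(1)]
          A.delta_in_apartment[OF a(1) p(1) xA] A.delta_in_apartment[OF a(1) xA q(1)] p(2) q(2) by simp
    qed
    obtain g where g: "g \<in> carrier G" "\<phi> g p = f p" "\<phi> g q = f q"
      using weyl iso[OF p(1) q(1), symmetric] A.A_C[OF p(1)] A.A_C[OF q(1)]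
        A'.A_C[OF f(1)[OF p(1)]] A'.A_C[OF f(1)[OF q(1)]] unfolding weyl_transitive_def by blast
    have "\<phi> g x = f x" if x: "x \<in> F" for x
    proof -
      have xA: "x \<in> A" using x F(2) by blast
      note C = A.A_C[OF xA] A.A_C[OF p(1)] A.A_C[OF q(1)]
      have "\<phi> g x \<in> C" using aut[OF g(1)] C(1) by (auto simp: building_automorphism_def bij_betw_def)
      moreover have gd: "\<delta> (f p) (\<phi> g x) = \<delta> p x" "\<delta> (\<phi> g x) (f q) = \<delta> x q"
        using automorphism_delta[OF aut[OF g(1)] C(2,1)] automorphism_delta[OF aut[OF g(1)] C(1,3)]
        by (simp_all add: g)
      moreover have "\<delta> p q = \<delta> p x \<otimes>\<^bsub>W\<^esub> \<delta> x q"
        using A.delta_in_apartment[OF p(1) xA q(1)] C by (simp add: W.m_assoc[symmetric])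
      ultimately show ?thesis
        using between[OF x] iso[OF p(1) xA] iso[OF xA q(1)]
        by (intro between_unique[OF A'.A_C[OF f(1)[OF p(1)]] _ A'.A_C[OF f(1)[OF xA]]
              A'.A_C[OF f(1)[OF q(1)]]]) simp_all
    qed
    then show ?thesis using g(1) by blast
  qed
  have "f ` A \<subseteq> C" using fA A'.A_sub by simp
  from proper_discrete_action_interpolation[OF proper T A.A_sub this finite]
  obtain g where g: "g \<in> carrier G" "\<forall>x\<in>A. \<phi> g x = f x" by blast
  have "\<phi> g ` A = A'" unfolding fA[symmetric] using g(2) by (intro image_cong) simp_all
  moreover have "\<phi> g a = a'" using g(2) fa a(1) by simp
  ultimately show "\<exists>g\<in>carrier G. \<phi> g a = a' \<and> \<phi> g ` A = A'" using g(1) by blast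
qed

end

theorem theorem5p16:
  fixes I :: "'i set" and M :: "'i \<Rightarrow> 'i \<Rightarrow> enat"
    and B :: "('c, 'i, 'i list set) coloured_graph"
    and G :: "('g, 'z) monoid_scheme" and T :: "'g topology" and \<phi> :: "'g \<Rightarrow> 'c \<Rightarrow> 'c"
  assumes "euclidean_building TYPE('v::euclidean_space) I M B"
    and "topological_group G T"
    and "acts_by_automorphisms G B \<phi>"
    and "proper_action G T (discrete_topology (chambers B)) \<phi>"
  shows "weyl_transitive G B \<phi> \<longleftrightarrow> strongly_transitive G (maximal_atlas I M B) \<phi>"
proof -
  have B: "building I M B" and E: "euclidean_type TYPE('v) I M"
    using assms(1) by (simp_all add: euclidean_building_def)
  have "coxeter_matrix I M" using B unfolding building_def by (elim conjE)
  then interpret building_of_type I M B using B by unfold_locales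
  have T: "topspace T = carrier G" using assms(2) by (simp add: topological_group_def)
  have aut: "building_automorphism B (\<phi> g)" if "g \<in> carrier G" for g
    using assms(3) that by (simp add: acts_by_automorphisms_def)
  show ?thesis
  proof
    assume "weyl_transitive G B \<phi>"
    with E T assms(4) aut show "strongly_transitive G (maximal_atlas I M B) \<phi>"
      by (rule weyl_imp_strongly_transitive)
  next
    assume "strongly_transitive G (maximal_atlas I M B) \<phi>"
    with aut show "weyl_transitive G B \<phi>" by (rule strongly_imp_weyl_transitive)
  qed
qed

end
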